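(* For every $0<\alpha<1$ and every integer $n\ge1$, there exist a compact convex body $K_\alpha\subset\mathbb{R}^2$ with $$\partial K_\alpha\in C^{1,\alpha}\setminus C^{1,1},$$ a bounded Lipschitz domain $\Omega\subset\mathbb{R}^n$, a map $$u\in C^{1,\alpha}(\overline\Omega;\mathbb{R}^2)\cap W^{1,2}(\Omega;\mathbb{R}^2\setminus\operatorname{int}K_\alpha),$$ and a point $x_0\in\Omega$ such that $u$ globally minimizes the Dirichlet energy in its fixed Sobolev trace class, i.e. $$\int_\Omega|Du|^2\,dx\le\int_\Omega|Dv|^2\,dx\quad\text{for every } v\in W^{1,2}(\Omega;\mathbb{R}^2\setminus\operatorname{int}K_\alpha)\text{ with }v-u\in W^{1,2}_0(\Omega;\mathbb{R}^2),$$ but $u$ does not belong to $C^{1,1}$ in any neighborhood of $x_0$.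
   Context: $W^{1,2}(\Omega;A)$ denotes the maps in $W^{1,2}(\Omega;\mathbb{R}^2)$ with values in $A$ almost everywhere. A convex body is a compact convex set with nonempty interior. $\partial K_\alpha\in C^{1,\alpha}$ (resp. $C^{1,1}$) means that the boundary is locally, after a rigid motion, the graph of a $C^{1,\alpha}$ (resp. $C^{1,1}$) function. *)

theory Defs
  imports "HOL-Analysis.Analysis"
begin

section \<open>Hoelder classes, boundaries and domains\<close>

definition holder_on :: "real \<Rightarrow> 'a::metric_space set \<Rightarrow> ('a \<Rightarrow> 'b::metric_space) \<Rightarrow> bool" where
  "holder_on \<alpha> S f \<longleftrightarrow> (\<exists>C. \<forall>x\<in>S. \<forall>y\<in>S. dist (f x) (f y) \<le> C * dist x y powr \<alpha>)"

text \<open>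
  The class of continuously differentiable functions on the open set \<open>S\<close> that extend, together
  with their derivative, continuously to the closure of \<open>S\<close>, the derivative being
  \<open>\<alpha>\<close>-Hoelder there; \<open>\<alpha> = 1\<close> gives the class with Lipschitz derivative. For bounded \<open>S\<close> the
  suprema of \<open>f\<close> and of its derivative are then automatically finite; for unbounded \<open>S\<close> they
  are not required to be.
\<close>

definition C1_holder :: "real \<Rightarrow> 'a::real_normed_vector set \<Rightarrow> ('a \<Rightarrow> 'b::real_normed_vector) \<Rightarrow> bool"
  where "C1_holder \<alpha> S f \<longleftrightarrow>
    continuous_on (closure S) f \<and>
    (\<exists>f' :: 'a \<Rightarrow> 'a \<Rightarrow>\<^sub>L 'b.
      (\<forall>x\<in>S. (f has_derivative blinfun_apply (f' x)) (at x)) \<and>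
      continuous_on (closure S) f' \<and> holder_on \<alpha> (closure S) f')"

definition convex_body :: "'a::euclidean_space set \<Rightarrow> bool" where
  "convex_body K \<longleftrightarrow> compact K \<and> convex K \<and> interior K \<noteq> {}"

definition rigid_motion :: "('a::euclidean_space \<Rightarrow> 'a) \<Rightarrow> bool" where
  "rigid_motion T \<longleftrightarrow> (\<exists>R a. orthogonal_transformation R \<and> T = (\<lambda>x. a + R x))"

text \<open>
  The graph function is taken on the whole line. This is no restriction: a function on an open
  interval can be restricted to a compact subinterval and continued affinely on both sides,
  which keeps its derivative Hoelder with the same exponent.
\<close>

definition C1_holder_boundary :: "real \<Rightarrow> (real^2) set \<Rightarrow> bool" where
  "C1_holder_boundary \<alpha> K \<longleftrightarrow>
    (\<forall>p\<in>frontier K. \<exists>T U (g :: real \<Rightarrow> real).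
      rigid_motion T \<and> open U \<and> p \<in> U \<and> C1_holder \<alpha> UNIV g \<and>
      T ` (frontier K \<inter> U) = {y \<in> T ` U. y $ 2 = g (y $ 1)})"

text \<open>
  Near each boundary point a bounded Lipschitz domain is, in suitable orthonormal coordinates,
  the region above the graph of a Lipschitz function of the first \<open>n - 1\<close> coordinates. Here \<open>e\<close>
  is the last basis vector, and the hyperplane orthogonal to \<open>e\<close> plays the role of the space of
  the first \<open>n - 1\<close> coordinates; in dimension one it is \<open>{0}\<close>.
\<close>

definition bounded_lipschitz_domain :: "'a::euclidean_space set \<Rightarrow> bool" where
  "bounded_lipschitz_domain \<Omega> \<longleftrightarrow>
    open \<Omega> \<and> connected \<Omega> \<and> \<Omega> \<noteq> {} \<and> bounded \<Omega> \<and>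
    (\<forall>p\<in>frontier \<Omega>. \<exists>e r L (g :: 'a \<Rightarrow> real).
      norm e = 1 \<and> r > 0 \<and> L-lipschitz_on {y. y \<bullet> e = 0} g \<and>
      \<Omega> \<inter> ball p r = {x \<in> ball p r. x \<bullet> e > g (x - (x \<bullet> e) *\<^sub>R e)})"


section \<open>Sobolev spaces\<close>

primrec Ck :: "nat \<Rightarrow> ('a::euclidean_space \<Rightarrow> 'b::real_normed_vector) \<Rightarrow> bool" where
  "Ck 0 f \<longleftrightarrow> continuous_on UNIV f"
| "Ck (Suc k) f \<longleftrightarrow>
    (\<forall>x. f differentiable (at x)) \<and> (\<forall>v. Ck k (\<lambda>x. frechet_derivative f (at x) v))"

definition test_functions :: "'a::euclidean_space set \<Rightarrow> ('a \<Rightarrow> 'b::real_normed_vector) set" where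
  "test_functions \<Omega> =
    {\<phi>. (\<forall>k. Ck k \<phi>) \<and> compact (closure {x. \<phi> x \<noteq> 0}) \<and> closure {x. \<phi> x \<noteq> 0} \<subseteq> \<Omega>}"

definition locally_integrable :: "'a::euclidean_space set \<Rightarrow> ('a \<Rightarrow> 'b::euclidean_space) \<Rightarrow> bool" where
  "locally_integrable \<Omega> f \<longleftrightarrow> (\<forall>C. compact C \<and> C \<subseteq> \<Omega> \<longrightarrow> f absolutely_integrable_on C)"

definition square_integrable :: "'a::euclidean_space set \<Rightarrow> ('a \<Rightarrow> 'b::euclidean_space) \<Rightarrow> bool" where
  "square_integrable \<Omega> f \<longleftrightarrow>
    f \<in> borel_measurable (lebesgue_on \<Omega>) \<and> integrable (lebesgue_on \<Omega>) (\<lambda>x. (norm (f x))\<^sup>2)"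

text \<open>
  Gradients are Jacobian matrices: \<open>G x $ j $ i\<close> is the \<open>i\<close>-th weak partial derivative of the
  \<open>j\<close>-th component. The norm on \<open>real^'n^'m\<close> is the Frobenius norm.
\<close>

definition has_weak_gradient ::
    "(real^'n) set \<Rightarrow> (real^'n \<Rightarrow> real^'m) \<Rightarrow> (real^'n \<Rightarrow> real^'n^'m) \<Rightarrow> bool" where
  "has_weak_gradient \<Omega> u G \<longleftrightarrow>
    locally_integrable \<Omega> u \<and> locally_integrable \<Omega> G \<and>
    (\<forall>\<phi>\<in>test_functions \<Omega>. \<forall>j i.
      (\<integral>x. u x $ j * frechet_derivative \<phi> (at x) (axis i 1) \<partial>lebesgue_on \<Omega>) =
      - (\<integral>x. G x $ j $ i * \<phi> x \<partial>lebesgue_on \<Omega>))"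

text \<open>The weak gradient is unique up to null sets; a representative is chosen.\<close>

definition weak_gradient :: "(real^'n) set \<Rightarrow> (real^'n \<Rightarrow> real^'m) \<Rightarrow> real^'n \<Rightarrow> real^'n^'m" where
  "weak_gradient \<Omega> u = (SOME G. has_weak_gradient \<Omega> u G)"

definition W12 :: "(real^'n) set \<Rightarrow> (real^'n \<Rightarrow> real^'m) set" where
  "W12 \<Omega> = {u. square_integrable \<Omega> u \<and>
    (\<exists>G. has_weak_gradient \<Omega> u G \<and> square_integrable \<Omega> G)}"

definition W12_into :: "(real^'n) set \<Rightarrow> (real^'m) set \<Rightarrow> (real^'n \<Rightarrow> real^'m) set" where
  "W12_into \<Omega> A = {u \<in> W12 \<Omega>. AE x in lebesgue_on \<Omega>. u x \<in> A}"

definition dirichlet_energy :: "(real^'n) set \<Rightarrow> (real^'n \<Rightarrow> real^'m) \<Rightarrow> real" where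
  "dirichlet_energy \<Omega> u = (\<integral>x. (norm (weak_gradient \<Omega> u x))\<^sup>2 \<partial>lebesgue_on \<Omega>)"

definition W12_norm :: "(real^'n) set \<Rightarrow> (real^'n \<Rightarrow> real^'m) \<Rightarrow> real" where
  "W12_norm \<Omega> u = sqrt ((\<integral>x. (norm (u x))\<^sup>2 \<partial>lebesgue_on \<Omega>) + dirichlet_energy \<Omega> u)"

text \<open>The closure of the test functions in the Sobolev norm.\<close>

definition W12_0 :: "(real^'n) set \<Rightarrow> (real^'n \<Rightarrow> real^'m) set" where
  "W12_0 \<Omega> = {w \<in> W12 \<Omega>. \<forall>\<epsilon>>0. \<exists>\<phi>\<in>test_functions \<Omega>. W12_norm \<Omega> (\<lambda>x. w x - \<phi> x) < \<epsilon>}"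

end

theory Submission
  imports Defs "HOL-Real_Asymp.Real_Asymp"
begin

text \<open>
  The obstacle \<open>K\<close> is a square with \<open>\<l>\<^sup>p\<close>-rounded corners, \<open>p = 1 + \<alpha>\<close>, and
  \<open>u(x) = \<gamma>(x\<^sub>i)\<close> where \<open>\<gamma>\<close> is the arclength parametrisation of the boundary of \<open>K\<close> across the point
  where a flat side meets a corner. Minimality follows from a calibration: a \<open>C\<^sup>1\<close> function
  \<open>F\<close> on the plane whose gradient has norm at most one off \<open>K\<close> and equals the unit tangent along
  \<open>\<gamma>\<close>. On the corner both cosine and sine of the tangent angle are functions of one
  coordinate only, so \<open>F(y) = a(y\<^sub>1) + a(y\<^sub>2)\<close> works. If \<open>v\<close> has the same trace as \<open>u\<close>, the integral over
  \<open>\<Omega>\<close> of the \<open>i\<close>-th derivative of \<open>F \<circ> v\<close> is that of \<open>F \<circ> u\<close>, namely the volume of \<open>\<Omega>\<close>,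
  while the integrand is at most \<open>\<bar>Dv\<bar>\<close>.
\<close>

subsection \<open>Smooth bump functions\<close>

text \<open>The exponent p = 1 + \<alpha> makes the slope of the corner grow like the \<alpha>-th
  power of the distance from the junction, so the unit tangent is \<alpha>-Hoelder there and no
  better; composing with one coordinate keeps this regularity. The complement of \<open>K\<close> is
  not convex, so being critical does not imply minimality; this is why a calibration is used. It
  controls the integral of the norm of Dv, and the energy is reached from there by t <= (1 + t^2) /
  2, an equality for \<open>u\<close> because its speed is one everywhere. The constraint enters
  only through the bound on the gradient of \<open>F\<close>, which fails inside \<open>K\<close>:
  at the centre of \<open>K\<close> the gradient is (1, 1). The C^1 perturbations of
  \<open>u\<close> that approximate \<open>v\<close> may cross \<open>K\<close>, so the limit is
  taken with a weaker bound valid in the whole plane, and the sharp bound is applied only to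
  \<open>v\<close>. Whatever is needed near an arc is extended to the full line or space. Graph,
  curve and \<open>u\<close> are then C^1 globally, and integration by parts needs no boundary
  regularity.\<close>

lemma Ck_continuous: "Ck k f \<Longrightarrow> continuous_on UNIV f"
  by (cases k) (auto simp: differentiable_imp_continuous_within continuous_at_imp_continuous_on)

lemma Ck_lower: "Ck (Suc k) f \<Longrightarrow> Ck k f"
proof (induction k arbitrary: f)
  case 0
  then show ?case using Ck_continuous[of "Suc 0" f] by simp
next
  case (Suc k)
  have "Ck k (\<lambda>x. frechet_derivative f (at x) v)" for v
    using Suc by (metis Ck.simps(2))
  with Suc.prems show ?case by auto
qed

lemma Ck_SucI:
  assumes "\<And>x. (f has_derivative f' x) (at x)" "\<And>v. Ck k (\<lambda>x. f' x v)"
  shows "Ck (Suc k) f"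
proof -
  have "frechet_derivative f (at x) = f' x" for x
    using frechet_derivative_at[OF assms(1)] by simp
  then show ?thesis using assms by (auto simp: differentiable_def)
qed

lemma Ck_SucD:
  "Ck (Suc k) f \<Longrightarrow> (f has_derivative frechet_derivative f (at x)) (at x)"
  by (simp add: frechet_derivative_works[symmetric])

lemma Ck_const: "Ck k (\<lambda>x. c)"
  by (induction k arbitrary: c) (simp, rule Ck_SucI[where f'="\<lambda>x v. 0"], auto)

lemma Ck_add: "Ck k f \<Longrightarrow> Ck k g \<Longrightarrow> Ck k (\<lambda>x. f x + g x)"
proof (induction k arbitrary: f g)
  case 0 then show ?case by (auto intro: continuous_intros)
next
  case (Suc k)
  show ?case
    by (rule Ck_SucI[where f'="\<lambda>x v. frechet_derivative f (at x) v + frechet_derivative g (at x) v"])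
      (use Suc in \<open>auto intro!: has_derivative_add Ck_SucD\<close>)
qed

lemma Ck_mult:
  fixes f g :: "'a::euclidean_space \<Rightarrow> real"
  shows "Ck k f \<Longrightarrow> Ck k g \<Longrightarrow> Ck k (\<lambda>x. f x * g x)"
proof (induction k arbitrary: f g)
  case 0 then show ?case by (auto intro: continuous_intros)
next
  case (Suc k)
  show ?case
  proof (rule Ck_SucI)
    show "((\<lambda>x. f x * g x) has_derivative
      (\<lambda>v. f x * frechet_derivative g (at x) v + frechet_derivative f (at x) v * g x)) (at x)" for x
      by (intro has_derivative_mult Ck_SucD) (use Suc in auto)
    show "Ck k (\<lambda>x. f x * frechet_derivative g (at x) v + frechet_derivative f (at x) v * g x)" for v
      using Suc Ck_lower[of k f] Ck_lower[of k g] by (intro Ck_add Suc.IH) auto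
  qed
qed

lemma Ck_prod:
  fixes f :: "'i \<Rightarrow> 'a::euclidean_space \<Rightarrow> real"
  assumes "finite I" "\<And>i. i \<in> I \<Longrightarrow> Ck k (f i)"
  shows "Ck k (\<lambda>x. \<Prod>i\<in>I. f i x)"
  using assms by (induction I) (auto intro: Ck_const Ck_mult)

text \<open>The exponential that is flat at 0, with the powers of 1/x that differentiation produces.
  Each derivative is a combination of two other members of the family, so one induction over all
  \<open>j\<close> gives smoothness.\<close>

definition flat_exp :: "nat \<Rightarrow> real \<Rightarrow> real" where
  "flat_exp j x = (if x > 0 then (1/x) ^ j * exp (-(1/x)) else 0)"

text \<open>The exponential series at 1/x dominates its single term of order j + 2. Two spare powers
  of x are kept, so that the difference quotient at 0 still tends to 0.\<close>

lemma flat_exp_bound: "\<bar>flat_exp j x\<bar> \<le> fact (j+2) * x\<^sup>2"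
proof (cases "x > 0")
  case True
  have "(1/x)^(j+2) / fact (j+2) \<le> exp (1/x)"
    using sum_le_suminf[OF summable_exp[of "1/x"], of "{j+2}"] True
    by (simp add: exp_def field_simps)
  then have "(1/x)^(j+2) \<le> fact (j+2) * exp (1/x)"
    using fact_gt_zero[of "j+2", where 'a=real] by (subst (asm) pos_divide_le_eq) (auto simp only: mult.commute)
  then have "(1/x)^(j+2) * exp(-(1/x)) \<le> fact (j+2)"
    by (subst exp_minus, subst divide_inverse[symmetric], subst pos_divide_le_eq) auto
  then have "(1/x)^j * (1/x)^2 * exp(-(1/x)) \<le> fact (j+2)"
    by (simp only: power_add)
  then have "(1/x)^j * (1/x)^2 * exp(-(1/x)) * x\<^sup>2 \<le> fact (j+2) * x\<^sup>2"
    by (rule mult_right_mono) auto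
  moreover have "(1/x)^j * (1/x)^2 * exp(-(1/x)) * x\<^sup>2 = \<bar>flat_exp j x\<bar>"
    using True by (simp add: flat_exp_def power2_eq_square)
  ultimately show ?thesis by metis
qed (simp add: flat_exp_def)

lemma flat_exp_deriv:
  "(flat_exp j has_real_derivative (flat_exp (j+2) x - j * flat_exp (j+1) x)) (at x)"
proof -
  consider "x > 0" | "x < 0" | "x = 0" by linarith
  then show ?thesis
  proof cases
    case 1
    have "((\<lambda>x. (1/x)^j * exp (-(1/x))) has_real_derivative
       (flat_exp (j+2) x - j * flat_exp (j+1) x)) (at x)"
    proof (cases j)
      case (Suc i)
      have "((\<lambda>x. (1/x)^Suc i * exp (-(1/x))) has_real_derivative
         (1 + real i) * (- 1 / x\<^sup>2 * (1/x)^i) * exp (-(1/x)) + exp (-(1/x)) * (1/x\<^sup>2) * (1/x)^Suc i) (at x)"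
        using 1 by (auto intro!: derivative_eq_intros simp: power2_eq_square simp del: power_Suc)
      also have "(1 + real i) * (- 1 / x\<^sup>2 * (1/x)^i) * exp (-(1/x)) + exp (-(1/x)) * (1/x\<^sup>2) * (1/x)^Suc i
        = flat_exp (j+2) x - j * flat_exp (j+1) x"
        using 1 Suc by (simp add: flat_exp_def power2_eq_square algebra_simps)
      finally show ?thesis by (simp add: Suc)
    qed (use 1 in \<open>auto intro!: derivative_eq_intros simp: flat_exp_def power2_eq_square\<close>)
    then show ?thesis
      by (rule has_field_derivative_transform_within_open[of _ _ _ "{0<..}"])
        (use 1 in \<open>auto simp: flat_exp_def\<close>)
  next
    case 2
    have "((\<lambda>x. 0) has_real_derivative (flat_exp (j+2) x - j * flat_exp (j+1) x)) (at x)"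
      using 2 by (simp add: flat_exp_def)
    then show ?thesis
      by (rule has_field_derivative_transform_within_open[of _ _ _ "{..<0}"])
        (use 2 in \<open>auto simp: flat_exp_def\<close>)
  next
    case 3
    have "((\<lambda>h. flat_exp j h / h) \<longlongrightarrow> 0) (at 0)"
    proof (rule Lim_null_comparison[where g="\<lambda>h. fact (j+2) * \<bar>h\<bar>"])
      show "\<forall>\<^sub>F h in at 0. norm (flat_exp j h / h) \<le> fact (j+2) * \<bar>h\<bar>"
      proof (rule eventually_mono[OF eventually_neq_at_within[of 0]])
        fix h :: real assume "h \<noteq> 0"
        then show "norm (flat_exp j h / h) \<le> fact (j+2) * \<bar>h\<bar>"
          using flat_exp_bound[of j h]
          unfolding real_norm_def abs_divide power2_eq_square
          by (subst pos_divide_le_eq) (simp_all only: zero_less_abs_iff mult.assoc abs_mult_self_eq, simp)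
      qed
      show "((\<lambda>h. fact (j+2) * \<bar>h\<bar>) \<longlongrightarrow> (0::real)) (at 0)"
        by (intro tendsto_mult_right_zero tendsto_rabs_zero) auto
    qed
    moreover have "flat_exp i 0 = 0" for i by (simp add: flat_exp_def)
    ultimately show ?thesis using 3 by (simp add: has_field_derivative_iff)
  qed
qed

lemma Ck_flat_exp: "Ck k (\<lambda>x::real^'n. flat_exp j (c * x $ i + d))"
proof (induction k arbitrary: j)
  case 0
  have "continuous_on UNIV (flat_exp j)"
    using DERIV_isCont[OF flat_exp_deriv] by (simp add: continuous_at_imp_continuous_on)
  then have "continuous_on UNIV (flat_exp j \<circ> (\<lambda>x::real^'n. c * x $ i + d))"
    by (intro continuous_on_compose continuous_intros) (auto intro: continuous_on_subset)
  then show ?case by (simp add: o_def)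
next
  case (Suc k)
  let ?l = "\<lambda>x::real^'n. c * x $ i + d"
  show ?case
  proof (rule Ck_SucI)
    show "((\<lambda>x. flat_exp j (?l x)) has_derivative
       (\<lambda>v. (flat_exp (j+2) (?l x) + (- real j) * flat_exp (j+1) (?l x)) * (c * v $ i))) (at x)" for x
      by (rule has_derivative_eq_rhs, rule has_derivative_compose[OF _ flat_exp_deriv[unfolded has_field_derivative_def], of ?l "\<lambda>v. c * v $ i"])
         (auto intro!: derivative_eq_intros bounded_linear.has_derivative[OF bounded_linear_vec_nth] simp: fun_eq_iff)
    show "Ck k (\<lambda>x. (flat_exp (j+2) (?l x) + (- real j) * flat_exp (j+1) (?l x)) * (c * v $ i))" for v
      by (intro Ck_mult Ck_add Ck_const Suc.IH)
  qed
qed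

text \<open>The products of \<open>k\<close> with the distances to the faces are spread out into the
  affine form of \<open>Ck_flat_exp\<close>. Growing \<open>k\<close> drives the bump to the
  indicator of the open box, which also dominates it.\<close>

definition box_bump :: "real^'n \<Rightarrow> real^'n \<Rightarrow> nat \<Rightarrow> real^'n \<Rightarrow> real" where
  "box_bump a b k x = (\<Prod>i\<in>UNIV. flat_exp 0 (real k * x $ i + (- real k * a $ i)) *
     flat_exp 0 ((- real k) * x $ i + real k * b $ i))"

lemma flat_exp_0: "0 \<le> flat_exp 0 x" "flat_exp 0 x \<le> 1"
  by (auto simp: flat_exp_def)

lemma box_bump_bounds: "0 \<le> box_bump a b k x" "box_bump a b k x \<le> 1"
  unfolding box_bump_def by (auto intro!: prod_nonneg prod_le_1 mult_nonneg_nonneg mult_le_one flat_exp_0)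

lemma box_bump_outside: "x \<notin> box a b \<Longrightarrow> box_bump a b k x = 0"
proof -
  assume "x \<notin> box a b"
  then obtain i where "x $ i \<le> a $ i \<or> b $ i \<le> x $ i" by (auto simp: mem_box_cart not_less)
  then have "flat_exp 0 (real k * x $ i + (- real k * a $ i)) *
     flat_exp 0 ((- real k) * x $ i + real k * b $ i) = 0"
    by (auto simp: flat_exp_def mult_le_cancel_left mult_less_cancel_left not_less)
  then show ?thesis unfolding box_bump_def by (intro prod_zero) auto
qed

lemma box_bump_test_function:
  assumes "cbox a b \<subseteq> \<Omega>"
  shows "box_bump a b k \<in> test_functions \<Omega>"
proof -
  have s: "closure {x. box_bump a b k x \<noteq> 0} \<subseteq> cbox a b"
    using box_bump_outside[of _ a b k] box_subset_cbox[of a b] by (intro closure_minimal) auto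
  moreover have "compact (closure {x. box_bump a b k x \<noteq> 0})"
    using s compact_Int_closed[OF compact_cbox[of a b] closed_closure] by (metis inf.absorb2)
  moreover have "Ck m (box_bump a b k)" for m
    unfolding box_bump_def[abs_def] by (intro Ck_prod Ck_mult Ck_flat_exp) auto
  ultimately show ?thesis using assms by (auto simp: test_functions_def)
qed

lemma box_bump_tendsto: "(\<lambda>k. box_bump a b k x) \<longlonglongrightarrow> indicator (box a b) x"
proof (cases "x \<in> box a b")
  case True
  have *: "(\<lambda>k. flat_exp 0 (real k * c)) \<longlonglongrightarrow> 1" if "c > 0" for c
  proof -
    have "(\<lambda>k. exp (-(1/(real k * c)))) \<longlonglongrightarrow> exp (- 0)"
      using that by real_asymp
    moreover have "\<forall>\<^sub>F k in sequentially. exp (-(1/(real k * c))) = flat_exp 0 (real k * c)"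
      using eventually_gt_at_top[of 0] by eventually_elim (use that in \<open>auto simp: flat_exp_def\<close>)
    ultimately show ?thesis by (simp add: tendsto_cong)
  qed
  have "(\<lambda>k. \<Prod>i\<in>UNIV. flat_exp 0 (real k * (x $ i - a $ i)) * flat_exp 0 (real k * (b $ i - x $ i)))
     \<longlonglongrightarrow> (\<Prod>i\<in>(UNIV::'a set). 1 * 1)"
    using True by (intro tendsto_prod tendsto_mult *) (auto simp: mem_box_cart)
  then show ?thesis using True by (simp add: box_bump_def algebra_simps)
qed (simp add: box_bump_outside)

subsection \<open>Weak gradients\<close>

text \<open>Open boxes generate the Borel sets and are closed under intersection, so a Dynkin
  argument applies. Lebesgue sets differ from Borel sets by null sets, and a density with all
  integrals zero vanishes almost everywhere.\<close>

lemma AE_zero_if_box_integrals_zero: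
  fixes f :: "'a::euclidean_space \<Rightarrow> real"
  assumes f: "integrable lebesgue f"
    and box: "\<And>a b. (LINT x:box a b|lebesgue. f x) = 0"
    and total: "(LINT x|lebesgue. f x) = 0"
  shows "AE x in lebesgue. f x = 0"
proof -
  have fA: "set_integrable lebesgue A f" if "A \<in> sets lebesgue" for A
    using f that unfolding set_integrable_def by (intro integrable_mult_indicator)
  have borel: "(LINT x:A|lebesgue. f x) = 0" if A: "A \<in> sets borel" for A
  proof -
    have "Int_stable (range (\<lambda>(a, b). box a b :: 'a set))"
      by (auto simp: Int_stable_def box_Int_box)
    moreover have "range (\<lambda>(a, b). box a b :: 'a set) \<subseteq> Pow UNIV" by auto
    moreover have "A \<in> sigma_sets UNIV (range (\<lambda>(a, b). box a b))"
      using A unfolding borel_eq_box by simp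
    ultimately show ?thesis
    proof (induction rule: sigma_sets_induct_disjoint)
      case (basic A) then show ?case using box by auto
    next
      case empty then show ?case by (simp add: set_lebesgue_integral_def)
    next
      \<comment> \<open>The whole space is not a box; its integral \<open>total\<close> is what
        complements need.\<close>
      case (compl A)
      then have "A \<in> sets borel" unfolding borel_eq_box by simp
      then have "A \<in> sets lebesgue" by simp
      then have "(LINT x:(UNIV - A) \<union> A|lebesgue. f x)
         = (LINT x:(UNIV - A)|lebesgue. f x) + (LINT x:A|lebesgue. f x)"
        using \<open>A \<in> sets lebesgue\<close> by (intro set_integral_Un fA) auto
      then show ?case using total compl by (simp add: set_lebesgue_integral_def)
    next
      case (union F)
      then have "F i \<in> sets borel" for i unfolding borel_eq_box by auto
      then have "F i \<in> sets lebesgue" for i by simp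
      then have "(LINT x:(\<Union>i. F i)|lebesgue. f x) = (\<Sum>i. LINT x:F i|lebesgue. f x)"
        using union(1) by (intro lebesgue_integral_countable_add fA) (auto simp: disjoint_family_on_def)
      then show ?case using union by simp
    qed
  qed
  have "(LINT x:A|lebesgue. f x) = 0" if A: "A \<in> sets lebesgue" for A
  proof -
    obtain S N N' where S: "A = S \<union> N" "N \<subseteq> N'" "N' \<in> null_sets lborel" "S \<in> sets lborel"
      using sets_completionE[OF A] by metis
    have "AE x in lebesgue. x \<notin> N'"
      using S(3) by (intro AE_completion AE_not_in)
    then have "AE x in lebesgue. (x \<in> S) = (x \<in> A)"
      by eventually_elim (use S in auto)
    then have "(LINT x:S|lebesgue. f x) = (LINT x:A|lebesgue. f x)"
      using A S borel_measurable_integrable[OF fA[unfolded set_integrable_def]]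
      by (intro set_integral_cong_set) (auto simp: set_borel_measurable_def)
    then show ?thesis using borel S by simp
  qed
  then show ?thesis
    using density_unique_real[of lebesgue f "\<lambda>_. 0"] f by (simp add: set_lebesgue_integral_def)
qed

lemma integrable_lebesgue_on_iff_support:
  fixes h :: "'a::euclidean_space \<Rightarrow> 'b::{banach,second_countable_topology}"
  assumes "\<Omega> \<in> sets lebesgue" "\<And>x. x \<notin> \<Omega> \<Longrightarrow> h x = 0"
  shows "integrable (lebesgue_on \<Omega>) h \<longleftrightarrow> integrable lebesgue h"
    and "integral\<^sup>L (lebesgue_on \<Omega>) h = integral\<^sup>L lebesgue h"
proof -
  have "(\<lambda>x. indicator \<Omega> x *\<^sub>R h x) = h" using assms by (auto simp: indicator_def)
  then show "integrable (lebesgue_on \<Omega>) h \<longleftrightarrow> integrable lebesgue h"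
    and "integral\<^sup>L (lebesgue_on \<Omega>) h = integral\<^sup>L lebesgue h"
    using assms by (simp_all add: integrable_restrict_space integral_restrict_space)
qed

lemma integrable_compact_support:
  fixes g \<phi> :: "'a::euclidean_space \<Rightarrow> real"
  assumes g: "g absolutely_integrable_on C" and C: "compact C" and \<phi>: "continuous_on UNIV \<phi>"
    and supp: "\<And>x. x \<notin> C \<Longrightarrow> \<phi> x = 0"
  shows "integrable lebesgue (\<lambda>x. g x * \<phi> x)"
proof -
  obtain B where B: "\<And>x. x \<in> C \<Longrightarrow> \<bar>\<phi> x\<bar> \<le> B"
    using compact_imp_bounded[OF compact_continuous_image[OF continuous_on_subset[OF \<phi>] C]]
    by (auto simp: bounded_iff)
  have eq: "(\<lambda>x. g x * \<phi> x) = (\<lambda>x. (indicator C x *\<^sub>R g x) * \<phi> x)"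
    using supp by (fastforce simp: indicator_def)
  have gi: "integrable lebesgue (\<lambda>x. indicator C x *\<^sub>R g x)"
    using g by (simp add: set_integrable_def)
  have m: "\<phi> \<in> borel_measurable lebesgue"
    using borel_measurable_continuous_onI[OF \<phi>] by (simp add: measurable_completion)
  show ?thesis unfolding eq
  proof (rule Bochner_Integration.integrable_bound)
    show "integrable lebesgue (\<lambda>x. B * (indicator C x *\<^sub>R g x))"
      using gi by simp
    show "(\<lambda>x. (indicator C x *\<^sub>R g x) * \<phi> x) \<in> borel_measurable lebesgue"
      using gi m by (intro borel_measurable_times) auto
    show "AE x in lebesgue. norm ((indicator C x *\<^sub>R g x) * \<phi> x) \<le> norm (B * (indicator C x *\<^sub>R g x))"
    proof (intro AE_I2)
      fix x show "norm ((indicator C x *\<^sub>R g x) * \<phi> x) \<le> norm (B * (indicator C x *\<^sub>R g x))"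
        using B[of x] by (cases "x \<in> C") (auto simp: abs_mult mult.commute intro!: mult_right_mono)
    qed
  qed
qed

lemma test_function_support:
  assumes "\<phi> \<in> test_functions \<Omega>"
  obtains C where "compact C" "C \<subseteq> \<Omega>" "\<And>x. x \<notin> C \<Longrightarrow> \<phi> x = 0"
  by (rule that[of "closure {x. \<phi> x \<noteq> 0}"])
    (use assms closure_subset[of "{x. \<phi> x \<noteq> 0}"] in \<open>auto simp only: test_functions_def\<close>)

lemma test_function_continuous: "\<phi> \<in> test_functions \<Omega> \<Longrightarrow> continuous_on UNIV \<phi>"
  using Ck_continuous by (auto simp only: test_functions_def)

lemma test_function_derivative:
  assumes "\<phi> \<in> test_functions \<Omega>"
  shows "(\<phi> has_derivative frechet_derivative \<phi> (at x)) (at x)"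
    "continuous_on UNIV (\<lambda>x. frechet_derivative \<phi> (at x) v)"
proof -
  have "Ck (Suc 0) \<phi>" using assms by (simp only: test_functions_def mem_Collect_eq)
  then show "(\<phi> has_derivative frechet_derivative \<phi> (at x)) (at x)"
    "continuous_on UNIV (\<lambda>x. frechet_derivative \<phi> (at x) v)"
    using Ck_SucD[of 0 \<phi>] by (blast, simp)
qed

lemma integrable_times_test_function:
  fixes g :: "real^'n \<Rightarrow> real"
  assumes "open \<Omega>" "locally_integrable \<Omega> g" "\<phi> \<in> test_functions \<Omega>"
  shows "integrable (lebesgue_on \<Omega>) (\<lambda>x. g x * \<phi> x)"
proof -
  obtain C where C: "compact C" "C \<subseteq> \<Omega>" "\<And>x. x \<notin> C \<Longrightarrow> \<phi> x = 0"
    using test_function_support[OF assms(3)] by metis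
  have "integrable lebesgue (\<lambda>x. g x * \<phi> x)"
    using C assms by (intro integrable_compact_support[where C="C"] test_function_continuous) (auto simp: locally_integrable_def)
  then show ?thesis
    using C assms by (subst integrable_lebesgue_on_iff_support) auto
qed

text \<open>Test functions approximating the indicator of a box turn the hypothesis into vanishing
  integrals over boxes. As \<open>g\<close> is only locally integrable, it is cut off to one box at
  a time, and countably many boxes exhaust \<open>\<Omega>\<close>.\<close>

lemma fundamental_lemma_calculus_of_variations:
  fixes g :: "real^'n \<Rightarrow> real"
  assumes \<Omega>: "open \<Omega>" and g: "locally_integrable \<Omega> g"
    and zero: "\<And>\<phi>. \<phi> \<in> test_functions \<Omega> \<Longrightarrow> (\<integral>x. g x * \<phi> x \<partial>lebesgue_on \<Omega>) = 0"
  shows "AE x in lebesgue_on \<Omega>. g x = 0"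
proof -
  have gC: "integrable lebesgue (\<lambda>x. indicator (cbox a b) x *\<^sub>R g x)" if "cbox a b \<subseteq> \<Omega>" for a b
    using g that by (auto simp: locally_integrable_def set_integrable_def)
  have gB: "integrable lebesgue (\<lambda>x. indicator (box a b) x *\<^sub>R g x)" if "cbox a b \<subseteq> \<Omega>" for a b
  proof -
    have "set_integrable lebesgue (cbox a b) g" using gC[OF that] by (simp add: set_integrable_def)
    then have "set_integrable lebesgue (box a b) g"
      by (rule set_integrable_subset) (auto simp: box_subset_cbox)
    then show ?thesis by (simp add: set_integrable_def)
  qed
  have box0: "(LINT x:box a b|lebesgue. g x) = 0" if ab: "cbox a b \<subseteq> \<Omega>" for a b
  proof -
    have "(\<lambda>k. LINT x|lebesgue. box_bump a b k x * g x) \<longlonglongrightarrow> (LINT x|lebesgue. indicator (box a b) x * g x)"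
    proof (rule integral_dominated_convergence)
      show "integrable lebesgue (\<lambda>x. norm (indicator (box a b) x *\<^sub>R g x))"
        using gB[OF ab] by (rule integrable_norm)
      show "(\<lambda>x. indicator (box a b) x * g x) \<in> borel_measurable lebesgue"
        using borel_measurable_integrable[OF gB[OF ab]] by simp
      show "(\<lambda>x. box_bump a b k x * g x) \<in> borel_measurable lebesgue" for k
      proof -
        have "integrable lebesgue (\<lambda>x. g x * box_bump a b k x)"
          using g ab box_bump_outside[of _ a b k] box_subset_cbox[of a b]
            test_function_continuous[OF box_bump_test_function[of a b UNIV k]]
          by (intro integrable_compact_support[where C="cbox a b"]) (auto simp: locally_integrable_def)
        then show ?thesis by (simp add: mult.commute)
      qed
      show "AE x in lebesgue. (\<lambda>k. box_bump a b k x * g x) \<longlonglongrightarrow> indicator (box a b) x * g x"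
        by (intro AE_I2 tendsto_mult box_bump_tendsto tendsto_const)
      show "AE x in lebesgue. norm (box_bump a b k x * g x) \<le> norm (indicator (box a b) x *\<^sub>R g x)" for k
      proof (intro AE_I2)
        fix x show "norm (box_bump a b k x * g x) \<le> norm (indicator (box a b) x *\<^sub>R g x)"
          using box_bump_bounds[of a b k x] box_bump_outside[of x a b k]
          by (cases "x \<in> box a b") (auto simp: abs_mult intro!: mult_left_le_one_le)
      qed
    qed
    moreover have "(LINT x|lebesgue. box_bump a b k x * g x) = 0" for k
    proof -
      have "(LINT x|lebesgue. g x * box_bump a b k x) = (\<integral>x. g x * box_bump a b k x \<partial>lebesgue_on \<Omega>)"
        using \<Omega> box_bump_outside[of _ a b k] box_subset_cbox[of a b] ab
        by (intro integrable_lebesgue_on_iff_support(2)[symmetric]) auto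
      then show ?thesis using zero[OF box_bump_test_function[OF ab]] by (simp add: mult.commute)
    qed
    ultimately show ?thesis
      using LIMSEQ_unique[OF _ tendsto_const] by (simp add: set_lebesgue_integral_def)
  qed
  have AEbox: "AE x in lebesgue. x \<in> cbox a b \<longrightarrow> g x = 0" if ab: "cbox a b \<subseteq> \<Omega>" for a b
  proof -
    have "AE x in lebesgue. indicator (box a b) x *\<^sub>R g x = 0"
    proof (rule AE_zero_if_box_integrals_zero[OF gB[OF ab]])
      show "(LINT x|lebesgue. indicator (box a b) x *\<^sub>R g x) = 0"
        using box0[OF ab] by (simp add: set_lebesgue_integral_def)
      fix c d :: "real^'n"
      \<comment> \<open>On a test box the cut-off function is \<open>g\<close> on the intersection,
        which is again a box inside \<open>\<Omega>\<close>.\<close>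
      obtain a' b' where e: "box c d \<inter> box a b = box a' b'" "cbox a' b' \<subseteq> cbox a b"
        by (rule that[OF box_Int_box]) (auto simp: mem_box)
      have "(\<lambda>x. indicator (box c d) x *\<^sub>R indicator (box a b) x *\<^sub>R g x) = (\<lambda>x. indicator (box a' b') x *\<^sub>R g x)"
        unfolding e(1)[symmetric] by (auto simp: indicator_def)
      then show "(LINT x:box c d|lebesgue. indicator (box a b) x *\<^sub>R g x) = 0"
        using box0[of a' b'] e ab by (simp add: set_lebesgue_integral_def)
    qed
    \<comment> \<open>The covering below uses closed boxes while the integrals see open ones; the
      difference is a negligible boundary.\<close>
    moreover have "AE x in lebesgue. x \<notin> cbox a b - box a b"
      using negligible_frontier_interval[of a b] by (intro AE_not_in) (simp add: negligible_iff_null_sets)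
    ultimately show ?thesis by eventually_elim auto
  qed
  obtain \<D> where D: "countable \<D>" "\<D> \<subseteq> Pow \<Omega>" "\<And>X. X \<in> \<D> \<Longrightarrow> \<exists>a b. X = cbox a b" "\<Union>\<D> = \<Omega>"
    using open_countable_Union_open_cbox[OF \<Omega>] by metis
  have "AE x in lebesgue. \<forall>X\<in>\<D>. x \<in> X \<longrightarrow> g x = 0"
    using D AEbox by (subst AE_ball_countable) force+
  then have "AE x in lebesgue. x \<in> \<Omega> \<longrightarrow> g x = 0"
    by eventually_elim (use D in auto)
  then show ?thesis using \<Omega> by (subst AE_restrict_space_iff) auto
qed

section \<open>Uniqueness and linearity of weak gradients\<close>

lemma locally_integrable_component:
  assumes "locally_integrable \<Omega> G"
  shows "locally_integrable \<Omega> (\<lambda>x. G x $ j)"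
  unfolding locally_integrable_def set_integrable_def
proof (intro allI impI)
  fix C assume "compact C \<and> C \<subseteq> \<Omega>"
  then have "integrable lebesgue (\<lambda>x. indicat_real C x *\<^sub>R G x)"
    using assms by (auto simp: locally_integrable_def set_integrable_def)
  then show "integrable lebesgue (\<lambda>x. indicat_real C x *\<^sub>R G x $ j)"
    using integrable_bounded_linear[OF bounded_linear_vec_nth[of j]] by fastforce
qed

lemma locally_integrable_diff:
  "locally_integrable \<Omega> f \<Longrightarrow> locally_integrable \<Omega> g \<Longrightarrow> locally_integrable \<Omega> (\<lambda>x. f x - g x)"
  by (auto simp: locally_integrable_def)

text \<open>\<open>weak_gradient\<close> is a chosen representative; uniqueness up to null sets
  allows energies to be computed from any explicit weak gradient.\<close>

lemma has_weak_gradient_unique: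
  fixes u :: "real^'n \<Rightarrow> real^'m"
  assumes "open \<Omega>" "has_weak_gradient \<Omega> u G" "has_weak_gradient \<Omega> u H"
  shows "AE x in lebesgue_on \<Omega>. G x = H x"
proof -
  have li: "locally_integrable \<Omega> (\<lambda>x. G x $ j $ i)" "locally_integrable \<Omega> (\<lambda>x. H x $ j $ i)" for j i
    using assms by (auto simp: has_weak_gradient_def intro!: locally_integrable_component)
  have "AE x in lebesgue_on \<Omega>. G x $ j $ i - H x $ j $ i = 0" for j i
  proof (rule fundamental_lemma_calculus_of_variations[OF assms(1)])
    show "locally_integrable \<Omega> (\<lambda>x. G x $ j $ i - H x $ j $ i)"
      by (intro locally_integrable_diff li)
    fix \<phi> :: "real^'n \<Rightarrow> real" assume \<phi>: "\<phi> \<in> test_functions \<Omega>"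
    have "(\<integral>x. (G x $ j $ i - H x $ j $ i) * \<phi> x \<partial>lebesgue_on \<Omega>) =
       (\<integral>x. G x $ j $ i * \<phi> x \<partial>lebesgue_on \<Omega>) - (\<integral>x. H x $ j $ i * \<phi> x \<partial>lebesgue_on \<Omega>)"
      unfolding left_diff_distrib
      by (intro Bochner_Integration.integral_diff integrable_times_test_function assms li \<phi>)
    then show "(\<integral>x. (G x $ j $ i - H x $ j $ i) * \<phi> x \<partial>lebesgue_on \<Omega>) = 0"
      using assms(2,3) \<phi> unfolding has_weak_gradient_def by (metis (no_types, lifting) diff_self neg_equal_iff_equal)
  qed
  then have "AE x in lebesgue_on \<Omega>. \<forall>j i. G x $ j $ i - H x $ j $ i = 0"
    by (simp add: AE_all_countable)
  then show ?thesis by eventually_elim (simp add: vec_eq_iff)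
qed

lemma has_weak_gradient_weak_gradient:
  "has_weak_gradient \<Omega> u G \<Longrightarrow> has_weak_gradient \<Omega> u (weak_gradient \<Omega> u)"
  unfolding weak_gradient_def by (rule someI[where P="has_weak_gradient \<Omega> u"])

lemma AE_weak_gradient:
  assumes "open \<Omega>" "has_weak_gradient \<Omega> u G"
  shows "AE x in lebesgue_on \<Omega>. weak_gradient \<Omega> u x = G x"
  using has_weak_gradient_unique[OF assms(1) has_weak_gradient_weak_gradient[OF assms(2)] assms(2)] .

text \<open>Splitting the integrals requires integrability of each piece, since a non-integrable
  function has the default integral 0; the compact support of the test function and of its
  derivative supplies it.\<close>

lemma has_weak_gradient_diff:
  fixes u v :: "real^'n \<Rightarrow> real^'m"
  assumes \<Omega>: "open \<Omega>" and u: "has_weak_gradient \<Omega> u G" and v: "has_weak_gradient \<Omega> v H"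
  shows "has_weak_gradient \<Omega> (\<lambda>x. u x - v x) (\<lambda>x. G x - H x)"
  unfolding has_weak_gradient_def
proof (intro conjI ballI allI)
  have l: "locally_integrable \<Omega> u" "locally_integrable \<Omega> v" "locally_integrable \<Omega> G" "locally_integrable \<Omega> H"
    using u v by (auto simp: has_weak_gradient_def)
  then show "locally_integrable \<Omega> (\<lambda>x. u x - v x)" "locally_integrable \<Omega> (\<lambda>x. G x - H x)"
    by (auto intro: locally_integrable_diff)
  fix \<phi> :: "real^'n \<Rightarrow> real" and j i assume \<phi>: "\<phi> \<in> test_functions \<Omega>"
  obtain C where C: "compact C" "C \<subseteq> \<Omega>" "\<And>x. x \<notin> C \<Longrightarrow> \<phi> x = 0"
    using test_function_support[OF \<phi>] by metis
  have out: "frechet_derivative \<phi> (at x) w = 0" if "x \<notin> C" for x w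
  proof -
    have "((\<lambda>_. 0) has_derivative (\<lambda>_. 0)) (at x)" by simp
    then have "(\<phi> has_derivative (\<lambda>_. 0)) (at x)"
      by (rule has_derivative_transform_within_open[of _ _ _ _ "- C"])
        (use that C compact_imp_closed[of C] in auto)
    then show ?thesis using frechet_derivative_at by metis
  qed
  have int: "integrable (lebesgue_on \<Omega>) (\<lambda>x. w x $ j * frechet_derivative \<phi> (at x) (axis i 1))"
    if w: "locally_integrable \<Omega> w" for w :: "real^'n \<Rightarrow> real^'m"
  proof -
    have "integrable lebesgue (\<lambda>x. w x $ j * frechet_derivative \<phi> (at x) (axis i 1))"
      using C out locally_integrable_component[OF w, of j]
      by (intro integrable_compact_support[where C="C"] test_function_derivative[OF \<phi>]) (auto simp: locally_integrable_def)
    then show ?thesis using C \<Omega> out by (subst integrable_lebesgue_on_iff_support) auto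
  qed
  have "(\<integral>x. (u x - v x) $ j * frechet_derivative \<phi> (at x) (axis i 1) \<partial>lebesgue_on \<Omega>)
    = (\<integral>x. u x $ j * frechet_derivative \<phi> (at x) (axis i 1) \<partial>lebesgue_on \<Omega>)
      - (\<integral>x. v x $ j * frechet_derivative \<phi> (at x) (axis i 1) \<partial>lebesgue_on \<Omega>)"
    unfolding left_diff_distrib vector_minus_component
    by (intro Bochner_Integration.integral_diff int l)
  also have "\<dots> = - (\<integral>x. G x $ j $ i * \<phi> x \<partial>lebesgue_on \<Omega>) + (\<integral>x. H x $ j $ i * \<phi> x \<partial>lebesgue_on \<Omega>)"
    using u v \<phi> by (simp add: has_weak_gradient_def)
  also have "\<dots> = - (\<integral>x. (G x - H x) $ j $ i * \<phi> x \<partial>lebesgue_on \<Omega>)"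
    unfolding left_diff_distrib vector_minus_component
    by (subst Bochner_Integration.integral_diff) (auto intro!: integrable_times_test_function locally_integrable_component \<Omega> l \<phi>)
  finally show "(\<integral>x. (u x - v x) $ j * frechet_derivative \<phi> (at x) (axis i 1) \<partial>lebesgue_on \<Omega>)
    = - (\<integral>x. (G x - H x) $ j $ i * \<phi> x \<partial>lebesgue_on \<Omega>)" .
qed

section \<open>Integration by parts for globally C^1 maps\<close>

lemma has_derivative_zero_outside:
  assumes "(f has_derivative D) (at x)" "closed C" "x \<notin> C" "\<And>y. y \<notin> C \<Longrightarrow> f y = 0"
  shows "D = (\<lambda>_. 0)"
proof -
  have "((\<lambda>_. 0) has_derivative (\<lambda>_. 0)) (at x)" by simp
  then have "(f has_derivative (\<lambda>_. 0)) (at x)"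
    by (rule has_derivative_transform_within_open[of _ _ _ _ "- C"]) (use assms in auto)
  then show ?thesis using has_derivative_unique[OF assms(1)] by simp
qed

lemma integrable_continuous_compact_support:
  fixes f :: "'a::euclidean_space \<Rightarrow> real"
  assumes "continuous_on UNIV f" "compact C" "\<And>x. x \<notin> C \<Longrightarrow> f x = 0"
  shows "integrable lborel f"
proof -
  have "integrable lborel (\<lambda>x. indicator C x *\<^sub>R f x)"
    using assms by (intro borel_integrable_compact) (auto intro: continuous_on_subset)
  moreover have "(\<lambda>x. indicator C x *\<^sub>R f x) = f" using assms(3) by (force simp: indicator_def)
  ultimately show ?thesis by simp
qed

text \<open>Difference quotients have integral zero by translation invariance.\<close>

lemma integral_derivative_compact_support:
  fixes f :: "'a::euclidean_space \<Rightarrow> real"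
  assumes f: "\<And>x. (f has_derivative f' x) (at x)" and cont: "continuous_on UNIV (\<lambda>x. f' x v)"
    and C: "compact C" "\<And>x. x \<notin> C \<Longrightarrow> f x = 0"
  shows "(LINT x|lebesgue. f' x v) = 0"
proof -
  have out: "f' x = (\<lambda>_. 0)" if "x \<notin> C" for x
    using has_derivative_zero_outside[OF f compact_imp_closed[OF C(1)] that C(2)] by simp
  have contf: "continuous_on UNIV f"
    using f by (meson continuous_at_imp_continuous_on has_derivative_continuous)
  have fint: "integrable lborel f" using integrable_continuous_compact_support[OF contf C] .
  obtain B where B: "\<And>x. \<bar>f' x v\<bar> \<le> B"
  proof -
    obtain B0 where "\<And>x. x \<in> C \<Longrightarrow> \<bar>f' x v\<bar> \<le> B0"
      using compact_imp_bounded[OF compact_continuous_image[OF continuous_on_subset[OF cont] C(1)]]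
      by (auto simp: bounded_iff)
    then have "\<bar>f' x v\<bar> \<le> max B0 0" for x by (cases "x \<in> C") (auto simp: out max.coboundedI1)
    then show ?thesis by (rule that)
  qed
  define h where "h k = 1 / real (Suc k)" for k
  have h: "0 < h k" "h k \<le> 1" for k by (auto simp: h_def)
  define D where "D k x = (f (h k *\<^sub>R v + x) - f x) / h k" for k x
  \<comment> \<open>All quotients have step at most 1, so \<open>C\<close> swept along
    \<open>- v\<close> by lengths in [0, 1] supports every one of them and carries an integrable
    bound.\<close>
  define S where "S = (\<lambda>(t, x). x - t *\<^sub>R v) ` ({0..1} \<times> C)"
  have "compact S"
    unfolding S_def case_prod_unfold
    by (intro compact_continuous_image compact_Times C continuous_intros) auto
  have line: "((\<lambda>t. f (x + t *\<^sub>R v)) has_derivative (\<lambda>s. s * f' (x + t *\<^sub>R v) v)) (at t within A)" for x t A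
  proof -
    have "((\<lambda>t. f (x + t *\<^sub>R v)) has_derivative (\<lambda>s. f' (x + t *\<^sub>R v) (s *\<^sub>R v))) (at t within A)"
      by (rule has_derivative_compose[OF _ f]) (auto intro!: derivative_eq_intros)
    then show ?thesis
      by (simp add: linear_scale[OF has_derivative_linear[OF f]])
  qed
  have Dlim: "(\<lambda>k. D k x) \<longlonglongrightarrow> f' x v" for x
  proof -
    have "((\<lambda>t. f (x + t *\<^sub>R v)) has_real_derivative f' x v) (at 0)"
      using line[of x 0 UNIV] unfolding has_field_derivative_def by (rule has_derivative_eq_rhs) (simp_all add: fun_eq_iff)
    then have lim: "((\<lambda>t. (f (t *\<^sub>R v + x) - f x) / t) \<longlongrightarrow> f' x v) (at 0)"
      by (simp add: DERIV_def add.commute)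
    have "filterlim h (at 0) sequentially"
      unfolding filterlim_at h_def using LIMSEQ_inverse_real_of_nat by (auto simp: inverse_eq_divide)
    from filterlim_compose[OF lim this] show ?thesis by (simp add: D_def)
  qed
  have Dbound: "\<bar>D k x\<bar> \<le> B" for k x
  proof -
    obtain t where "f (x + h k *\<^sub>R v) - f (x + 0 *\<^sub>R v) = (h k - 0) * f' (x + t *\<^sub>R v) v"
    proof (rule mvt[OF h(1)[of k], of "\<lambda>t. f (x + t *\<^sub>R v)" "\<lambda>t s. s * f' (x + t *\<^sub>R v) v"])
      show "continuous_on {0..h k} (\<lambda>t. f (x + t *\<^sub>R v))"
        by (intro continuous_on_compose2[OF contf] continuous_intros) auto
    qed (use line in auto)
    then have "D k x = f' (x + t *\<^sub>R v) v"
      using h(1)[of k] by (simp add: D_def add.commute)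
    then show ?thesis using B by simp
  qed
  have Dout: "D k x = 0" if "x \<notin> S" for k x
  proof -
    have "h k *\<^sub>R v + x \<notin> C"
      using that h[of k] unfolding S_def by (force intro!: image_eqI[where x="(h k, h k *\<^sub>R v + x)"])
    moreover have "x \<notin> C" using that unfolding S_def by (force intro!: image_eqI[where x="(0, x)"])
    ultimately show ?thesis using C by (simp add: D_def)
  qed
  have m: "f \<in> borel_measurable borel" using contf by (rule borel_measurable_continuous_onI)
  have trans: "integrable lborel (\<lambda>x. f (c + x))" "(LINT x|lborel. f (c + x)) = (LINT x|lborel. f x)" for c
  proof -
    have "integrable (distr lborel borel ((+) c)) f" using fint by (simp add: lborel_distr_plus)
    then show "integrable lborel (\<lambda>x. f (c + x))" by (subst (asm) integrable_distr_eq) (auto simp: m)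
    have "(LINT x|distr lborel borel ((+) c). f x) = (LINT x|lborel. f (c + x))"
      by (rule integral_distr) (auto simp: m)
    then show "(LINT x|lborel. f (c + x)) = (LINT x|lborel. f x)" by (simp add: lborel_distr_plus)
  qed
  have "(\<lambda>k. LINT x|lborel. D k x) \<longlonglongrightarrow> (LINT x|lborel. f' x v)"
  proof (rule integral_dominated_convergence[where w="\<lambda>x. B * indicator S x"])
    show "integrable lborel (\<lambda>x. B * indicator S x)"
      using \<open>compact S\<close> emeasure_compact_finite[of S] compact_imp_closed[of S] by auto
    show "(\<lambda>x. f' x v) \<in> borel_measurable lborel"
      using borel_measurable_continuous_onI[OF cont] by simp
    show "D k \<in> borel_measurable lborel" for k
      unfolding D_def using m by measurable
    show "AE x in lborel. (\<lambda>k. D k x) \<longlonglongrightarrow> f' x v" using Dlim by simp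
    show "AE x in lborel. norm (D k x) \<le> B * indicator S x" for k
      using Dbound Dout by (auto simp: indicator_def)
  qed
  moreover have "(LINT x|lborel. D k x) = 0" for k
    unfolding D_def using trans fint by simp
  ultimately have "(LINT x|lborel. f' x v) = 0" using LIMSEQ_unique[OF _ tendsto_const] by simp
  then show ?thesis
    using borel_measurable_continuous_onI[OF cont] by (simp add: integral_completion)
qed

lemma absolutely_integrable_continuous_compact:
  fixes f :: "'a::euclidean_space \<Rightarrow> 'b::euclidean_space"
  assumes "compact C" "continuous_on C f"
  shows "f absolutely_integrable_on C"
  using borel_integrable_compact[OF assms] assms(1)
  by (auto simp: set_integrable_def intro!: integrable_completion[THEN iffD2] borel_measurable_integrable)

definition jacobian :: "(real^'n \<Rightarrow> real^'n \<Rightarrow> real^'m) \<Rightarrow> real^'n \<Rightarrow> real^'n^'m" where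
  "jacobian u' x = (\<chi> j i. u' x (axis i 1) $ j)"

lemma continuous_on_jacobian:
  "(\<And>v. continuous_on S (\<lambda>x. u' x v)) \<Longrightarrow> continuous_on S (jacobian u')"
  unfolding jacobian_def[abs_def] by (intro continuous_on_vec_lambda continuous_on_component)

text \<open>The product of a component of \<open>u\<close> with a test function is C^1 with compact
  support, so its partial derivative integrates to zero over the whole space; by the product rule
  this is the defining identity.\<close>

lemma C1_has_weak_gradient:
  fixes u :: "real^'n \<Rightarrow> real^'m"
  assumes \<Omega>: "open \<Omega>" and u: "\<And>x. (u has_derivative u' x) (at x)"
    and cont: "\<And>v. continuous_on UNIV (\<lambda>x. u' x v)"
  shows "has_weak_gradient \<Omega> u (jacobian u')"
  unfolding has_weak_gradient_def
proof (intro conjI ballI allI)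
  have contu: "continuous_on UNIV u"
    using u by (meson continuous_at_imp_continuous_on has_derivative_continuous)
  show "locally_integrable \<Omega> u" "locally_integrable \<Omega> (jacobian u')"
    unfolding locally_integrable_def
    by (auto intro!: absolutely_integrable_continuous_compact continuous_on_subset[OF contu]
        continuous_on_subset[OF continuous_on_jacobian[OF cont]])
  fix \<phi> :: "real^'n \<Rightarrow> real" and j i assume \<phi>: "\<phi> \<in> test_functions \<Omega>"
  obtain C where C: "compact C" "C \<subseteq> \<Omega>" "\<And>x. x \<notin> C \<Longrightarrow> \<phi> x = 0"
    using test_function_support[OF \<phi>] by metis
  let ?e = "axis i 1 :: real^'n" and ?\<phi>' = "\<lambda>x. frechet_derivative \<phi> (at x)"
  note \<phi>' = test_function_derivative[OF \<phi>]
  have out: "?\<phi>' x v = 0" if "x \<notin> C" for x v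
    using has_derivative_zero_outside[OF \<phi>'(1) compact_imp_closed[OF C(1)] that C(3)] by metis
  have prod: "((\<lambda>x. u x $ j * \<phi> x) has_derivative (\<lambda>v. u x $ j * ?\<phi>' x v + u' x v $ j * \<phi> x)) (at x)" for x
    by (intro has_derivative_mult \<phi>' bounded_linear.has_derivative[OF bounded_linear_vec_nth] u)
  have c1: "continuous_on UNIV (\<lambda>x. u x $ j * ?\<phi>' x ?e)"
    by (intro continuous_on_mult continuous_on_component contu \<phi>')
  have c2: "continuous_on UNIV (\<lambda>x. u' x ?e $ j * \<phi> x)"
    by (intro continuous_on_mult continuous_on_component cont test_function_continuous[OF \<phi>])
  have leb: "integrable lebesgue g" if "continuous_on UNIV g" "\<And>x. x \<notin> C \<Longrightarrow> g x = 0" for g :: "real^'n \<Rightarrow> real"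
    using integrable_continuous_compact_support[OF that(1) C(1) that(2)]
    by (auto simp: integrable_completion borel_measurable_integrable)
  have "(LINT x|lebesgue. u x $ j * ?\<phi>' x ?e + u' x ?e $ j * \<phi> x) = 0"
    using c1 c2 C by (intro integral_derivative_compact_support[OF prod, of _ C] continuous_on_add) auto
  then have "(LINT x|lebesgue. u x $ j * ?\<phi>' x ?e) + (LINT x|lebesgue. u' x ?e $ j * \<phi> x) = 0"
    using leb[OF c1] leb[OF c2] C out by (subst (asm) Bochner_Integration.integral_add) auto
  then show "(\<integral>x. u x $ j * ?\<phi>' x ?e \<partial>lebesgue_on \<Omega>) = - (\<integral>x. jacobian u' x $ j $ i * \<phi> x \<partial>lebesgue_on \<Omega>)"
    using C out \<Omega> by (subst (1 2) integrable_lebesgue_on_iff_support(2)) (auto simp: jacobian_def)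
qed

subsection \<open>Calibrations\<close>

lemma borel_measurable_lebesgue_on_AE:
  fixes f g :: "'a::euclidean_space \<Rightarrow> 'b::euclidean_space"
  assumes "\<Omega> \<in> sets lebesgue" "f \<in> borel_measurable (lebesgue_on \<Omega>)" "AE x in lebesgue_on \<Omega>. f x = g x"
  shows "g \<in> borel_measurable (lebesgue_on \<Omega>)"
proof -
  have "(\<lambda>x. indicator \<Omega> x *\<^sub>R f x) \<in> borel_measurable lebesgue"
    using assms by (subst (asm) borel_measurable_restrict_space_iff) auto
  moreover have "AE x in lebesgue. indicator \<Omega> x *\<^sub>R f x = indicator \<Omega> x *\<^sub>R g x"
    using assms by (subst (asm) AE_restrict_space_iff) (auto elim!: eventually_mono simp: indicator_def)
  ultimately have "(\<lambda>x. indicator \<Omega> x *\<^sub>R g x) \<in> borel_measurable lebesgue"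
    by (rule borel_measurable_AE)
  then show ?thesis using assms(1) by (subst borel_measurable_restrict_space_iff) auto
qed

lemma square_integrable_diff:
  fixes f g :: "'a::euclidean_space \<Rightarrow> 'b::euclidean_space"
  assumes "square_integrable \<Omega> f" "square_integrable \<Omega> g"
  shows "square_integrable \<Omega> (\<lambda>x. f x - g x)"
  unfolding square_integrable_def
proof
  show "(\<lambda>x. f x - g x) \<in> borel_measurable (lebesgue_on \<Omega>)"
    using assms by (auto simp: square_integrable_def)
  show "integrable (lebesgue_on \<Omega>) (\<lambda>x. (norm (f x - g x))\<^sup>2)"
  proof (rule Bochner_Integration.integrable_bound)
    show "integrable (lebesgue_on \<Omega>) (\<lambda>x. 2 * (norm (f x))\<^sup>2 + 2 * (norm (g x))\<^sup>2)"
      using assms by (auto simp: square_integrable_def)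
    show "(\<lambda>x. (norm (f x - g x))\<^sup>2) \<in> borel_measurable (lebesgue_on \<Omega>)"
      using assms by (auto simp: square_integrable_def)
    show "AE x in lebesgue_on \<Omega>. norm ((norm (f x - g x))\<^sup>2) \<le> norm (2 * (norm (f x))\<^sup>2 + 2 * (norm (g x))\<^sup>2)"
    proof (intro AE_I2)
      fix x
      have "(norm (f x - g x))\<^sup>2 \<le> (norm (f x) + norm (g x))\<^sup>2"
        by (intro power_mono norm_triangle_ineq4) auto
      also have "\<dots> \<le> 2 * (norm (f x))\<^sup>2 + 2 * (norm (g x))\<^sup>2"
        using sum_squares_bound[of "norm (f x)" "norm (g x)"] by (simp add: power2_sum)
      finally show "norm ((norm (f x - g x))\<^sup>2) \<le> norm (2 * (norm (f x))\<^sup>2 + 2 * (norm (g x))\<^sup>2)" by simp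
    qed
  qed
qed

lemma finite_measure_lebesgue_on:
  fixes \<Omega> :: "'a::euclidean_space set"
  assumes "open \<Omega>" "bounded \<Omega>"
  shows "finite_measure (lebesgue_on \<Omega>)" "measure (lebesgue_on \<Omega>) \<Omega> = measure lebesgue \<Omega>"
proof -
  have "emeasure lebesgue \<Omega> < \<infinity>"
    using assms emeasure_bounded_finite[of \<Omega>] by simp
  then show "finite_measure (lebesgue_on \<Omega>)"
    using assms by (intro finite_measureI) (auto simp: emeasure_restrict_space space_restrict_space)
  show "measure (lebesgue_on \<Omega>) \<Omega> = measure lebesgue \<Omega>"
    using assms by (subst measure_restrict_space) auto
qed

lemma borel_measurable_continuous_lebesgue_on:
  fixes f :: "'a::euclidean_space \<Rightarrow> 'b::euclidean_space"
  assumes "continuous_on UNIV f"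
  shows "f \<in> borel_measurable (lebesgue_on \<Omega>)"
  using borel_measurable_continuous_onI[OF assms]
  by (intro measurable_restrict_space1 measurable_completion) simp

lemma bounded_continuous_image:
  fixes f :: "'a::euclidean_space \<Rightarrow> 'b::euclidean_space"
  assumes "continuous_on UNIV f" "bounded \<Omega>"
  obtains B where "\<And>x. x \<in> \<Omega> \<Longrightarrow> norm (f x) \<le> B"
proof -
  have "bounded (f ` closure \<Omega>)"
    using assms by (intro compact_imp_bounded compact_continuous_image) (auto intro: continuous_on_subset)
  then obtain B where "\<And>x. x \<in> closure \<Omega> \<Longrightarrow> norm (f x) \<le> B" by (auto simp: bounded_iff)
  then show ?thesis using that closure_subset[of \<Omega>] by blast
qed

lemma integrable_continuous_lebesgue_on:
  fixes f :: "'a::euclidean_space \<Rightarrow> 'b::euclidean_space"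
  assumes "open \<Omega>" "bounded \<Omega>" "continuous_on UNIV f"
  shows "integrable (lebesgue_on \<Omega>) f"
proof -
  obtain B where B: "\<And>x. x \<in> \<Omega> \<Longrightarrow> norm (f x) \<le> B" using bounded_continuous_image[OF assms(3,2)] by metis
  interpret finite_measure "lebesgue_on \<Omega>" using finite_measure_lebesgue_on assms by auto
  show ?thesis
    by (rule integrable_const_bound[of _ B])
      (use B borel_measurable_continuous_lebesgue_on[OF assms(3)] in \<open>auto simp: space_restrict_space\<close>)
qed

lemma square_integrable_continuous:
  fixes f :: "'a::euclidean_space \<Rightarrow> 'b::euclidean_space"
  assumes "open \<Omega>" "bounded \<Omega>" "continuous_on UNIV f"
  shows "square_integrable \<Omega> f"
  unfolding square_integrable_def
  using assms by (auto intro!: borel_measurable_continuous_lebesgue_on integrable_continuous_lebesgue_on continuous_intros)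

text \<open>Integrated form of t <= (\<delta> + t^2 / \<delta>) / 2, in place of Cauchy-Schwarz.
  Small \<open>\<delta>\<close> turns convergence in L^2 into convergence in L^1;
  \<open>\<delta>\<close> = 1 is the passage from length to energy.\<close>

lemma square_integrable_L1:
  fixes f :: "'a::euclidean_space \<Rightarrow> 'b::euclidean_space"
  assumes "open \<Omega>" "bounded \<Omega>" "square_integrable \<Omega> f"
  shows "integrable (lebesgue_on \<Omega>) f"
    and "\<delta> > 0 \<Longrightarrow> (\<integral>x. norm (f x) \<partial>lebesgue_on \<Omega>) \<le>
       (\<delta> * measure lebesgue \<Omega> + (\<integral>x. (norm (f x))\<^sup>2 \<partial>lebesgue_on \<Omega>) / \<delta>) / 2"
proof -
  interpret finite_measure "lebesgue_on \<Omega>" using finite_measure_lebesgue_on assms by auto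
  have amgm: "t \<le> (\<delta> + t\<^sup>2 / \<delta>) / 2" if "\<delta> > 0" for t \<delta> :: real
    using that sum_squares_bound[of t \<delta>] by (simp add: field_simps power2_eq_square)
  have sq: "integrable (lebesgue_on \<Omega>) (\<lambda>x. (norm (f x))\<^sup>2)" and m: "f \<in> borel_measurable (lebesgue_on \<Omega>)"
    using assms by (auto simp: square_integrable_def)
  show int: "integrable (lebesgue_on \<Omega>) f"
  proof (rule Bochner_Integration.integrable_bound)
    show "integrable (lebesgue_on \<Omega>) (\<lambda>x. (1 + (norm (f x))\<^sup>2 / 1) / 2)" using sq by auto
    show "AE x in lebesgue_on \<Omega>. norm (f x) \<le> norm ((1 + (norm (f x))\<^sup>2 / 1) / 2)"
    proof (rule AE_I2)
      fix x show "norm (f x) \<le> norm ((1 + (norm (f x))\<^sup>2 / 1) / 2)"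
        using amgm[of 1 "norm (f x)"] by (simp add: abs_of_nonneg)
    qed
  qed (rule m)
  assume \<delta>: "\<delta> > 0"
  have "(\<integral>x. norm (f x) \<partial>lebesgue_on \<Omega>) \<le> (\<integral>x. (\<delta> + (norm (f x))\<^sup>2 / \<delta>) / 2 \<partial>lebesgue_on \<Omega>)"
    using sq int amgm[OF \<delta>] by (intro integral_mono) auto
  also have "\<dots> = (\<delta> * measure lebesgue \<Omega> + (\<integral>x. (norm (f x))\<^sup>2 \<partial>lebesgue_on \<Omega>) / \<delta>) / 2"
    using sq finite_measure_lebesgue_on[OF assms(1,2)] by (simp add: space_restrict_space)
  finally show "(\<integral>x. norm (f x) \<partial>lebesgue_on \<Omega>) \<le>
       (\<delta> * measure lebesgue \<Omega> + (\<integral>x. (norm (f x))\<^sup>2 \<partial>lebesgue_on \<Omega>) / \<delta>) / 2" .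
qed

text \<open>The chosen representative agrees almost everywhere with a square-integrable gradient;
  its measurability follows from completeness of Lebesgue measure.\<close>

lemma W12_weak_gradient:
  assumes "open \<Omega>" "u \<in> W12 \<Omega>"
  shows "has_weak_gradient \<Omega> u (weak_gradient \<Omega> u)" "square_integrable \<Omega> (weak_gradient \<Omega> u)"
    "square_integrable \<Omega> u"
proof -
  obtain G where G: "has_weak_gradient \<Omega> u G" "square_integrable \<Omega> G" and u: "square_integrable \<Omega> u"
    using assms by (auto simp: W12_def)
  show "has_weak_gradient \<Omega> u (weak_gradient \<Omega> u)" by (rule has_weak_gradient_weak_gradient[OF G(1)])
  have ae: "AE x in lebesgue_on \<Omega>. G x = weak_gradient \<Omega> u x"
    using AE_weak_gradient[OF assms(1) G(1)] by eventually_elim simp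
  have m: "weak_gradient \<Omega> u \<in> borel_measurable (lebesgue_on \<Omega>)"
    by (rule borel_measurable_lebesgue_on_AE[OF _ _ ae]) (use G(2) assms(1) in \<open>simp_all add: square_integrable_def\<close>)
  have "integrable (lebesgue_on \<Omega>) (\<lambda>x. (norm (weak_gradient \<Omega> u x))\<^sup>2)"
  proof (rule integrable_cong_AE_imp)
    show "integrable (lebesgue_on \<Omega>) (\<lambda>x. (norm (G x))\<^sup>2)" using G by (simp add: square_integrable_def)
    show "(\<lambda>x. (norm (weak_gradient \<Omega> u x))\<^sup>2) \<in> borel_measurable (lebesgue_on \<Omega>)" using m by measurable
    show "AE x in lebesgue_on \<Omega>. (norm (G x))\<^sup>2 = (norm (weak_gradient \<Omega> u x))\<^sup>2"
      using ae by eventually_elim simp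
  qed
  then show "square_integrable \<Omega> (weak_gradient \<Omega> u)" using m by (simp add: square_integrable_def)
  show "square_integrable \<Omega> u" by (rule u)
qed

lemma dirichlet_energy_eq:
  assumes "open \<Omega>" "has_weak_gradient \<Omega> u G" "G \<in> borel_measurable (lebesgue_on \<Omega>)"
  shows "dirichlet_energy \<Omega> u = (\<integral>x. (norm (G x))\<^sup>2 \<partial>lebesgue_on \<Omega>)"
proof -
  have ae: "AE x in lebesgue_on \<Omega>. weak_gradient \<Omega> u x = G x"
    using AE_weak_gradient assms by blast
  then have "AE x in lebesgue_on \<Omega>. G x = weak_gradient \<Omega> u x" by eventually_elim simp
  from borel_measurable_lebesgue_on_AE[OF _ assms(3) this]
  have m: "weak_gradient \<Omega> u \<in> borel_measurable (lebesgue_on \<Omega>)"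
    using assms(1) by simp
  show ?thesis unfolding dirichlet_energy_def
  proof (rule integral_cong_AE)
    show "(\<lambda>x. (norm (weak_gradient \<Omega> u x))\<^sup>2) \<in> borel_measurable (lebesgue_on \<Omega>)" using m by measurable
    show "(\<lambda>x. (norm (G x))\<^sup>2) \<in> borel_measurable (lebesgue_on \<Omega>)" using assms(3) by measurable
    show "AE x in lebesgue_on \<Omega>. (norm (weak_gradient \<Omega> u x))\<^sup>2 = (norm (G x))\<^sup>2"
      using ae by eventually_elim simp
  qed
qed

lemma C1_W12:
  fixes u :: "real^'n \<Rightarrow> real^'m"
  assumes "open \<Omega>" "bounded \<Omega>" and u: "\<And>x. (u has_derivative u' x) (at x)"
    and cont: "\<And>v. continuous_on UNIV (\<lambda>x. u' x v)"
  shows "u \<in> W12 \<Omega>"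
    "dirichlet_energy \<Omega> u = (\<integral>x. (norm (jacobian u' x))\<^sup>2 \<partial>lebesgue_on \<Omega>)"
proof -
  have "continuous_on UNIV u"
    using u by (meson continuous_at_imp_continuous_on has_derivative_continuous)
  then show "u \<in> W12 \<Omega>"
    unfolding W12_def mem_Collect_eq
    by (intro conjI exI[of _ "jacobian u'"] square_integrable_continuous C1_has_weak_gradient continuous_on_jacobian)
      (use assms in auto)
  show "dirichlet_energy \<Omega> u = (\<integral>x. (norm (jacobian u' x))\<^sup>2 \<partial>lebesgue_on \<Omega>)"
    using assms by (intro dirichlet_energy_eq C1_has_weak_gradient borel_measurable_continuous_lebesgue_on
       continuous_on_jacobian)
qed

lemma norm_column_le:
  fixes M :: "real^'n^'m"
  shows "norm (column i M) \<le> norm M"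
  unfolding norm_vec_def[of M] norm_vec_def[of "column i M"]
  by (intro L2_set_mono) (simp_all add: column_def component_le_norm_cart[unfolded real_norm_def])

lemma column_jacobian: "column i (jacobian u' x) = u' x (axis i 1)"
  by (simp add: column_def jacobian_def vec_eq_iff)

lemma column_diff: "column i (A - B) = column i A - column i (B :: 'a::ab_group_add^'n^'m)"
  by (simp add: column_def vec_eq_iff)

lemma bounded_linear_column: "bounded_linear (\<lambda>M::real^'n^'m. column i M)"
  by (rule bounded_linear_intro[where K=1])
    (auto simp: column_def vec_eq_iff norm_column_le[unfolded column_def])

text \<open>
  The test functions approximating the competitor minus \<open>u\<close> make \<open>F\<close> of the competitor agree
  with \<open>F \<circ> u\<close> near the boundary, so the integral of its derivative in direction \<open>i\<close> is fixed;
  this passes to the Sobolev limit because the gradient \<open>X\<close> of \<open>F\<close> is bounded and continuous.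
\<close>

lemma calibration_dirichlet_lower_bound:
  fixes u v :: "real^'n \<Rightarrow> real^'m" and F :: "real^'m \<Rightarrow> real" and i :: 'n
  assumes \<Omega>: "open \<Omega>" "bounded \<Omega>"
    and u: "\<And>x. (u has_derivative u' x) (at x)" "\<And>h. continuous_on UNIV (\<lambda>x. u' x h)"
    and F: "\<And>y. (F has_derivative (\<lambda>h. X y \<bullet> h)) (at y)"
    and X: "continuous_on UNIV X" "\<And>y. norm (X y) \<le> M"
    and calib: "\<And>x. x \<in> \<Omega> \<Longrightarrow> X (u x) \<bullet> u' x (axis i 1) = 1"
    and v: "v \<in> W12 \<Omega>" "AE x in lebesgue_on \<Omega>. norm (X (v x)) \<le> 1"
    and trace: "(\<lambda>x. v x - u x) \<in> W12_0 \<Omega>"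
  shows "measure lebesgue \<Omega> \<le> dirichlet_energy \<Omega> v"
proof -
  define \<mu> where "\<mu> = lebesgue_on \<Omega>"
  define V where "V x = column i (weak_gradient \<Omega> v x)" for x
  define \<epsilon> where "\<epsilon> k = 1 / real (Suc k)" for k
  let ?e = "axis i 1 :: real^'n"
  have \<epsilon>: "\<epsilon> k > 0" for k by (simp add: \<epsilon>_def)
  note Gv = W12_weak_gradient[OF \<Omega>(1) v(1)]
  have contu: "continuous_on UNIV u"
    using u by (meson continuous_at_imp_continuous_on has_derivative_continuous)
  have "\<exists>\<phi>. \<forall>k. \<phi> k \<in> test_functions \<Omega> \<and> W12_norm \<Omega> (\<lambda>x. (v x - u x) - \<phi> k x) < \<epsilon> k"
    using trace \<epsilon> by (intro choice) (auto simp: W12_0_def)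
  then obtain \<phi> where \<phi>: "\<And>k. \<phi> k \<in> test_functions \<Omega>"
    and small: "\<And>k. W12_norm \<Omega> (\<lambda>x. (v x - u x) - \<phi> k x) < \<epsilon> k" by auto
  define \<phi>' where "\<phi>' k x = frechet_derivative (\<phi> k) (at x)" for k x
  have \<phi>': "(\<phi> k has_derivative \<phi>' k x) (at x)" "continuous_on UNIV (\<lambda>x. \<phi>' k x h)" for k x h
    unfolding \<phi>'_def by (rule test_function_derivative[OF \<phi>])+
  \<comment> \<open>\<open>w k\<close> is the C^1 approximation of \<open>v\<close> that equals
    \<open>u\<close> outside a compact subset of \<open>\<Omega>\<close>; \<open>d k\<close> is its
    derivative in direction \<open>i\<close>.\<close>
  define w where "w k x = u x + \<phi> k x" for k x
  define d where "d k x = u' x ?e + \<phi>' k x ?e" for k x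
  have contw: "continuous_on UNIV (w k)" for k
    unfolding w_def by (intro continuous_on_add contu test_function_continuous[OF \<phi>])
  have contd: "continuous_on UNIV (d k)" for k
    unfolding d_def by (intro continuous_on_add u \<phi>')
  have sqV: "square_integrable \<Omega> V"
  proof -
    have Vm: "V \<in> borel_measurable (lebesgue_on \<Omega>)"
      unfolding V_def
    proof (rule measurable_compose[where g="column i :: real^'n^'m \<Rightarrow> real^'m"])
      show "weak_gradient \<Omega> v \<in> borel_measurable (lebesgue_on \<Omega>)"
        using Gv(2) by (simp add: square_integrable_def)
      show "(column i :: real^'n^'m \<Rightarrow> real^'m) \<in> borel_measurable borel"
        by (intro borel_measurable_continuous_onI linear_continuous_on bounded_linear_column)
    qed
    moreover have "integrable (lebesgue_on \<Omega>) (\<lambda>x. (norm (V x))\<^sup>2)"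
    proof (rule Bochner_Integration.integrable_bound)
      show "integrable (lebesgue_on \<Omega>) (\<lambda>x. (norm (weak_gradient \<Omega> v x))\<^sup>2)"
        using Gv(2) by (simp add: square_integrable_def)
      show "(\<lambda>x. (norm (V x))\<^sup>2) \<in> borel_measurable (lebesgue_on \<Omega>)" using Vm by measurable
    qed (auto simp: V_def norm_column_le power_mono)
    ultimately show ?thesis by (simp add: square_integrable_def)
  qed
  have sq_w: "square_integrable \<Omega> (\<lambda>x. v x - w k x)" for k
    by (intro square_integrable_diff Gv square_integrable_continuous \<Omega> contw)
  have sq_d: "square_integrable \<Omega> (\<lambda>x. V x - d k x)" for k
    by (intro square_integrable_diff sqV square_integrable_continuous \<Omega> contd)
  \<comment> \<open>The Sobolev norm of the difference bounds both squared integrals separately, and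
    a single column is no longer than the full gradient.\<close>
  have close: "(\<integral>x. (norm (v x - w k x))\<^sup>2 \<partial>\<mu>) \<le> (\<epsilon> k)\<^sup>2" "(\<integral>x. (norm (V x - d k x))\<^sup>2 \<partial>\<mu>) \<le> (\<epsilon> k)\<^sup>2" for k
  proof -
    let ?G = "\<lambda>x. weak_gradient \<Omega> v x - jacobian u' x - jacobian (\<phi>' k) x"
    have G: "has_weak_gradient \<Omega> (\<lambda>x. (v x - u x) - \<phi> k x) ?G"
      by (intro has_weak_gradient_diff \<Omega> Gv C1_has_weak_gradient u \<phi>')
    have sqG: "square_integrable \<Omega> ?G"
      by (intro square_integrable_diff Gv square_integrable_continuous \<Omega> continuous_on_jacobian u \<phi>')
    have E: "dirichlet_energy \<Omega> (\<lambda>x. (v x - u x) - \<phi> k x) = (\<integral>x. (norm (?G x))\<^sup>2 \<partial>\<mu>)"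
      unfolding \<mu>_def using sqG by (intro dirichlet_energy_eq \<Omega> G) (simp add: square_integrable_def)
    have "(\<integral>x. (norm (v x - u x - \<phi> k x))\<^sup>2 \<partial>\<mu>) + (\<integral>x. (norm (?G x))\<^sup>2 \<partial>\<mu>) \<le> (\<epsilon> k)\<^sup>2"
    proof -
      have "W12_norm \<Omega> (\<lambda>x. (v x - u x) - \<phi> k x) \<le> \<epsilon> k" using small[of k] by simp
      then show ?thesis unfolding W12_norm_def E
        using sqrt_le_D unfolding \<mu>_def by auto
    qed
    moreover have "(\<integral>x. (norm (v x - u x - \<phi> k x))\<^sup>2 \<partial>\<mu>) \<ge> 0" "(\<integral>x. (norm (?G x))\<^sup>2 \<partial>\<mu>) \<ge> 0" by auto
    ultimately have le: "(\<integral>x. (norm (v x - u x - \<phi> k x))\<^sup>2 \<partial>\<mu>) \<le> (\<epsilon> k)\<^sup>2" "(\<integral>x. (norm (?G x))\<^sup>2 \<partial>\<mu>) \<le> (\<epsilon> k)\<^sup>2"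
      by linarith+
    show "(\<integral>x. (norm (v x - w k x))\<^sup>2 \<partial>\<mu>) \<le> (\<epsilon> k)\<^sup>2"
      using le(1) by (simp add: w_def algebra_simps)
    have "column i (?G x) = V x - d k x" for x
      by (simp add: V_def d_def column_diff column_jacobian)
    then have "norm (V x - d k x) \<le> norm (?G x)" for x by (metis norm_column_le)
    then have "(\<integral>x. (norm (V x - d k x))\<^sup>2 \<partial>\<mu>) \<le> (\<integral>x. (norm (?G x))\<^sup>2 \<partial>\<mu>)"
      using sqG sq_d[of k] unfolding \<mu>_def
      by (intro integral_mono power_mono) (auto simp: square_integrable_def)
    then show "(\<integral>x. (norm (V x - d k x))\<^sup>2 \<partial>\<mu>) \<le> (\<epsilon> k)\<^sup>2" using le(2) by simp
  qed
  have lim0: "(\<lambda>k. \<epsilon> k * (measure lebesgue \<Omega> + 1) / 2) \<longlonglongrightarrow> 0"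
    unfolding \<epsilon>_def by real_asymp
  have L1: "(\<lambda>k. \<integral>x. norm (f k x) \<partial>\<mu>) \<longlonglongrightarrow> 0"
    if "\<And>k. square_integrable \<Omega> (f k)" "\<And>k. (\<integral>x. (norm (f k x))\<^sup>2 \<partial>\<mu>) \<le> (\<epsilon> k)\<^sup>2" for f :: "nat \<Rightarrow> real^'n \<Rightarrow> real^'m"
  proof (rule tendsto_sandwich[OF _ _ tendsto_const lim0])
    show "\<forall>\<^sub>F k in sequentially. (\<integral>x. norm (f k x) \<partial>\<mu>) \<le> \<epsilon> k * (measure lebesgue \<Omega> + 1) / 2"
    proof (intro always_eventually allI)
      fix k
      have "(\<integral>x. norm (f k x) \<partial>\<mu>) \<le> (\<epsilon> k * measure lebesgue \<Omega> + (\<integral>x. (norm (f k x))\<^sup>2 \<partial>\<mu>) / \<epsilon> k) / 2"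
        unfolding \<mu>_def using square_integrable_L1(2)[OF \<Omega> that(1) \<epsilon>] .
      also have "(\<integral>x. (norm (f k x))\<^sup>2 \<partial>\<mu>) / \<epsilon> k \<le> \<epsilon> k"
        using that(2)[of k] \<epsilon>[of k] by (simp add: pos_divide_le_eq power2_eq_square)
      finally show "(\<integral>x. norm (f k x) \<partial>\<mu>) \<le> \<epsilon> k * (measure lebesgue \<Omega> + 1) / 2"
        by (simp add: algebra_simps)
    qed
  qed auto
  have L1w: "(\<lambda>k. \<integral>x. norm (v x - w k x) \<partial>\<mu>) \<longlonglongrightarrow> 0" by (rule L1[OF sq_w close(1)])
  have L1d: "(\<lambda>k. \<integral>x. norm (V x - d k x) \<partial>\<mu>) \<longlonglongrightarrow> 0" by (rule L1[OF sq_d close(2)])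
  \<comment> \<open>Convergence in L^1 yields a subsequence converging almost everywhere, to which
    the continuity of \<open>X\<close> applies.\<close>
  have "\<exists>r::nat\<Rightarrow>nat. strict_mono r \<and> (AE x in \<mu>. (\<lambda>k. v x - w (r k) x) \<longlonglongrightarrow> 0)"
    using square_integrable_L1(1)[OF \<Omega> sq_w] by (intro tendsto_L1_AE_subseq L1w) (simp add: \<mu>_def)
  then obtain r :: "nat \<Rightarrow> nat" where r: "strict_mono r" "AE x in \<mu>. (\<lambda>k. v x - w (r k) x) \<longlonglongrightarrow> 0"
    by auto
  have intV: "integrable \<mu> V" unfolding \<mu>_def by (rule square_integrable_L1[OF \<Omega> sqV])
  have intd: "integrable \<mu> (\<lambda>x. V x - d k x)" for k unfolding \<mu>_def by (rule square_integrable_L1[OF \<Omega> sq_d])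
  have Xm: "(\<lambda>x. X (f x)) \<in> borel_measurable \<mu>" if "f \<in> borel_measurable \<mu>" for f
    using measurable_compose[OF that borel_measurable_continuous_onI[OF X(1)]] .
  have wm: "w k \<in> borel_measurable \<mu>" for k
    unfolding \<mu>_def by (rule borel_measurable_continuous_lebesgue_on[OF contw])
  have vm: "v \<in> borel_measurable \<mu>" using Gv(3) by (simp add: square_integrable_def \<mu>_def)
  have Xle: "\<bar>X a \<bullet> b\<bar> \<le> M * norm b" for a b
    using Cauchy_Schwarz_ineq2[of "X a" b] mult_right_mono[OF X(2)[of a] norm_ge_zero[of b]] by linarith
  have inner_int: "integrable \<mu> (\<lambda>x. X (f x) \<bullet> g x)" and inner_bd: "\<bar>\<integral>x. X (f x) \<bullet> g x \<partial>\<mu>\<bar> \<le> M * (\<integral>x. norm (g x) \<partial>\<mu>)"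
    if "f \<in> borel_measurable \<mu>" "integrable \<mu> g" for f g
  proof -
    note le = Xle[of "f x" "g x" for x]
    show int: "integrable \<mu> (\<lambda>x. X (f x) \<bullet> g x)"
    proof (rule Bochner_Integration.integrable_bound)
      show "integrable \<mu> (\<lambda>x. M * norm (g x))" using that by simp
      show "(\<lambda>x. X (f x) \<bullet> g x) \<in> borel_measurable \<mu>"
        using Xm[OF that(1)] that(2) by (intro borel_measurable_inner) auto
    qed (use le order_trans[OF le abs_ge_self] in auto)
    have "\<bar>\<integral>x. X (f x) \<bullet> g x \<partial>\<mu>\<bar> \<le> (\<integral>x. \<bar>X (f x) \<bullet> g x\<bar> \<partial>\<mu>)" by (rule integral_abs_bound)
    also have "\<dots> \<le> (\<integral>x. M * norm (g x) \<partial>\<mu>)"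
      using le int that by (intro integral_mono) auto
    finally show "\<bar>\<integral>x. X (f x) \<bullet> g x \<partial>\<mu>\<bar> \<le> M * (\<integral>x. norm (g x) \<partial>\<mu>)" by simp
  qed
  \<comment> \<open>\<open>F\<close> of \<open>w k\<close> minus \<open>F\<close> of
    \<open>u\<close> has compact support, so its derivative integrates to zero and the flux of
    \<open>w k\<close> equals that of \<open>u\<close>, which \<open>calib\<close>
    evaluates.\<close>
  have flux: "(\<integral>x. X (w k x) \<bullet> d k x \<partial>\<mu>) = measure lebesgue \<Omega>" for k
  proof -
    obtain C where C: "compact C" "C \<subseteq> \<Omega>" "\<And>x. x \<notin> C \<Longrightarrow> \<phi> k x = 0"
      using test_function_support[OF \<phi>] by metis
    have out: "\<phi>' k x h = 0" if "x \<notin> C" for x h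
      using has_derivative_zero_outside[OF \<phi>'(1) compact_imp_closed[OF C(1)] that C(3)] by metis
    have zero: "\<phi> k x = 0" "\<phi>' k x h = 0" if "x \<notin> \<Omega>" for x h
      using that C out by blast+
    have w': "(w k has_derivative (\<lambda>h. u' x h + \<phi>' k x h)) (at x)" for x
      unfolding w_def[abs_def] by (intro has_derivative_add u \<phi>')
    have deriv: "((\<lambda>x. F (w k x) - F (u x)) has_derivative
       (\<lambda>h. X (w k x) \<bullet> (u' x h + \<phi>' k x h) - X (u x) \<bullet> u' x h)) (at x)" for x
      by (intro has_derivative_diff has_derivative_compose[OF w' F] has_derivative_compose[OF u(1) F])
    have c: "continuous_on UNIV (\<lambda>x. X (w k x) \<bullet> d k x)" "continuous_on UNIV (\<lambda>x. X (u x) \<bullet> u' x ?e)"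
      by (intro continuous_on_inner continuous_on_compose2[OF X(1)] contw contd contu u; simp)+
    have "(LINT x|lebesgue. X (w k x) \<bullet> (u' x ?e + \<phi>' k x ?e) - X (u x) \<bullet> u' x ?e) = 0"
      by (rule integral_derivative_compact_support[OF deriv _ C(1)])
        (use c C in \<open>auto intro!: continuous_on_diff simp: d_def w_def\<close>)
    then have "(\<integral>x. X (w k x) \<bullet> d k x - X (u x) \<bullet> u' x ?e \<partial>\<mu>) = 0"
      unfolding \<mu>_def d_def
      by (subst integrable_lebesgue_on_iff_support(2)) (use \<Omega> zero in \<open>simp_all add: w_def\<close>)
    then have "(\<integral>x. X (w k x) \<bullet> d k x \<partial>\<mu>) = (\<integral>x. X (u x) \<bullet> u' x ?e \<partial>\<mu>)"
      using Bochner_Integration.integral_diff[OF integrable_continuous_lebesgue_on[OF \<Omega> c(1)]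
          integrable_continuous_lebesgue_on[OF \<Omega> c(2)]] unfolding \<mu>_def by linarith
    also have "\<dots> = (\<integral>x. 1 \<partial>\<mu>)"
      unfolding \<mu>_def using calib by (intro Bochner_Integration.integral_cong) (auto simp: space_restrict_space)
    also have "\<dots> = measure lebesgue \<Omega>"
      using finite_measure_lebesgue_on[OF \<Omega>] by (simp add: \<mu>_def space_restrict_space)
    finally show ?thesis .
  qed
  \<comment> \<open>Only the bound \<open>M\<close> is available here, since \<open>w k\<close> may
    take values where \<open>X\<close> is longer than one.\<close>
  have "(\<lambda>k. \<integral>x. X (w (r k) x) \<bullet> V x \<partial>\<mu>) \<longlonglongrightarrow> (\<integral>x. X (v x) \<bullet> V x \<partial>\<mu>)"
  proof (rule integral_dominated_convergence[where w="\<lambda>x. M * norm (V x)"])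
    show "integrable \<mu> (\<lambda>x. M * norm (V x))" using intV by simp
    show "(\<lambda>x. X (v x) \<bullet> V x) \<in> borel_measurable \<mu>" "(\<lambda>x. X (w (r k) x) \<bullet> V x) \<in> borel_measurable \<mu>" for k
      using inner_int[OF vm intV] inner_int[OF wm intV] by auto
    show "AE x in \<mu>. (\<lambda>k. X (w (r k) x) \<bullet> V x) \<longlonglongrightarrow> X (v x) \<bullet> V x"
      using r(2)
    proof eventually_elim
      fix x assume "(\<lambda>k. v x - w (r k) x) \<longlonglongrightarrow> 0"
      from tendsto_diff[OF tendsto_const[of "v x"] this] have "(\<lambda>k. w (r k) x) \<longlonglongrightarrow> v x" by simp
      then have "(\<lambda>k. X (w (r k) x)) \<longlonglongrightarrow> X (v x)"
        using X(1) by (intro isCont_tendsto_compose[of _ X]) (auto simp: continuous_on_eq_continuous_at)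
      then show "(\<lambda>k. X (w (r k) x) \<bullet> V x) \<longlonglongrightarrow> X (v x) \<bullet> V x" by (intro tendsto_intros)
    qed
    show "AE x in \<mu>. norm (X (w (r k) x) \<bullet> V x) \<le> M * norm (V x)" for k
      by (intro AE_I2) (simp add: Xle)
  qed
  moreover have "(\<lambda>k. \<integral>x. X (w (r k) x) \<bullet> (V x - d (r k) x) \<partial>\<mu>) \<longlonglongrightarrow> 0"
  proof (rule Lim_null_comparison)
    show "\<forall>\<^sub>F k in sequentially. norm (\<integral>x. X (w (r k) x) \<bullet> (V x - d (r k) x) \<partial>\<mu>) \<le> M * (\<integral>x. norm (V x - d (r k) x) \<partial>\<mu>)"
      using inner_bd[OF wm intd] by simp
    show "(\<lambda>k. M * (\<integral>x. norm (V x - d (r k) x) \<partial>\<mu>)) \<longlonglongrightarrow> 0"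
      using LIMSEQ_subseq_LIMSEQ[OF L1d r(1)] by (intro tendsto_mult_right_zero) (simp add: o_def)
  qed
  ultimately have "(\<lambda>k. (\<integral>x. X (w (r k) x) \<bullet> V x \<partial>\<mu>) - (\<integral>x. X (w (r k) x) \<bullet> (V x - d (r k) x) \<partial>\<mu>))
     \<longlonglongrightarrow> (\<integral>x. X (v x) \<bullet> V x \<partial>\<mu>) - 0"
    by (rule tendsto_diff)
  moreover have "(\<integral>x. X (w k x) \<bullet> V x \<partial>\<mu>) - (\<integral>x. X (w k x) \<bullet> (V x - d k x) \<partial>\<mu>) = measure lebesgue \<Omega>" for k
  proof -
    have "(\<integral>x. X (w k x) \<bullet> V x \<partial>\<mu>) - (\<integral>x. X (w k x) \<bullet> (V x - d k x) \<partial>\<mu>)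
       = (\<integral>x. X (w k x) \<bullet> V x - X (w k x) \<bullet> (V x - d k x) \<partial>\<mu>)"
      using inner_int[OF wm intV] inner_int[OF wm intd] by simp
    also have "\<dots> = (\<integral>x. X (w k x) \<bullet> d k x \<partial>\<mu>)" by (simp add: inner_diff_right)
    finally show ?thesis using flux by simp
  qed
  ultimately have "measure lebesgue \<Omega> = (\<integral>x. X (v x) \<bullet> V x \<partial>\<mu>)"
    using LIMSEQ_unique[OF tendsto_const] by simp
  also have "\<dots> \<le> (\<integral>x. norm (V x) \<partial>\<mu>)"
  proof (rule integral_mono_AE)
    show "AE x in \<mu>. X (v x) \<bullet> V x \<le> norm (V x)"
      using v(2) unfolding \<mu>_def
    proof eventually_elim
      fix x assume "norm (X (v x)) \<le> 1"
      then show "X (v x) \<bullet> V x \<le> norm (V x)"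
        using norm_cauchy_schwarz[of "X (v x)" "V x"] mult_right_mono[of "norm (X (v x))" 1 "norm (V x)"] by simp
    qed
  qed (use inner_int[OF vm intV] intV in auto)
  \<comment> \<open>The choice \<delta> = 1 is the one with equality at speed one.\<close>
  also have "\<dots> \<le> (1 * measure lebesgue \<Omega> + (\<integral>x. (norm (V x))\<^sup>2 \<partial>\<mu>) / 1) / 2"
    unfolding \<mu>_def by (rule square_integrable_L1(2)[OF \<Omega> sqV]) simp
  finally have "2 * measure lebesgue \<Omega> \<le> measure lebesgue \<Omega> + (\<integral>x. (norm (V x))\<^sup>2 \<partial>\<mu>)" by simp
  moreover have "(\<integral>x. (norm (V x))\<^sup>2 \<partial>\<mu>) \<le> dirichlet_energy \<Omega> v"
    unfolding dirichlet_energy_def \<mu>_def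
  proof (rule integral_mono)
    show "(norm (V x))\<^sup>2 \<le> (norm (weak_gradient \<Omega> v x))\<^sup>2" for x
      by (simp add: V_def norm_column_le power_mono)
  qed (use Gv(2) sqV in \<open>simp_all add: square_integrable_def\<close>)
  ultimately show ?thesis by linarith
qed

subsection \<open>The rounded square\<close>

lemma powr_diff_le:
  fixes x y \<alpha> :: real
  assumes "0 < \<alpha>" "\<alpha> < 1" "0 \<le> y" "y \<le> x"
  shows "x powr \<alpha> - y powr \<alpha> \<le> (x - y) powr \<alpha>"
proof (cases "x = 0")
  case False
  then have x: "x > 0" using assms by linarith
  \<comment> \<open>A number in [0, 1] is at most its \<alpha>-th power; adding this for (x - y)/x
    and y/x, whose sum is 1, gives subadditivity.\<close>
  have le: "t / x \<le> (t / x) powr \<alpha>" if "0 \<le> t" "t \<le> x" for t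
    using powr_mono'[of \<alpha> 1 "t / x"] that x assms by simp
  have "1 = (x - y) / x + y / x" using x by (simp add: field_simps)
  also have "\<dots> \<le> ((x - y) / x) powr \<alpha> + (y / x) powr \<alpha>"
    using le[of "x - y"] le[of y] assms by linarith
  also have "\<dots> = ((x - y) powr \<alpha> + y powr \<alpha>) / x powr \<alpha>"
    using assms x by (simp add: powr_divide add_divide_distrib)
  finally show ?thesis using x by (simp add: le_divide_eq)
qed (use assms in auto)

definition ramp :: "real \<Rightarrow> real \<Rightarrow> real" where
  "ramp a x = max 0 x powr a"

lemma ramp_nonneg: "0 \<le> ramp a x"
  by (simp add: ramp_def)

lemma ramp_mono: "0 < a \<Longrightarrow> x \<le> y \<Longrightarrow> ramp a x \<le> ramp a y"
  by (simp add: ramp_def powr_mono2)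

lemma continuous_on_ramp [continuous_intros]:
  "0 < a \<Longrightarrow> continuous_on S f \<Longrightarrow> continuous_on S (\<lambda>x. ramp a (f x))"
  unfolding ramp_def by (intro continuous_on_powr' continuous_intros) auto

lemma ramp_holder:
  assumes "0 < \<alpha>" "\<alpha> < 1"
  shows "\<bar>ramp \<alpha> x - ramp \<alpha> y\<bar> \<le> \<bar>x - y\<bar> powr \<alpha>"
proof (induction x y rule: linorder_wlog)
  case (le x y)
  have "ramp \<alpha> y - ramp \<alpha> x \<le> (max 0 y - max 0 x) powr \<alpha>"
    unfolding ramp_def using assms le by (intro powr_diff_le) auto
  also have "\<dots> \<le> (y - x) powr \<alpha>" using assms le by (intro powr_mono2) auto
  finally show ?case using ramp_mono[OF assms(1) le] le by simp
qed (simp add: abs_minus_commute)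

lemma ramp_has_derivative:
  assumes "1 < p"
  shows "(ramp p has_real_derivative p * ramp (p - 1) x) (at x)"
proof -
  consider "x > 0" | "x < 0" | "x = 0" by linarith
  then show ?thesis
  proof cases
    case 1
    have "((\<lambda>x. x powr p) has_real_derivative p * ramp (p - 1) x) (at x)"
      using has_real_derivative_powr[OF 1, of p] 1 by (simp add: ramp_def)
    then show ?thesis
      by (rule has_field_derivative_transform_within_open[of _ _ _ "{0<..}"])
        (use 1 in \<open>auto simp: ramp_def\<close>)
  next
    case 2
    have "((\<lambda>x. 0) has_real_derivative p * ramp (p - 1) x) (at x)"
      using 2 by (simp add: ramp_def)
    then show ?thesis
      by (rule has_field_derivative_transform_within_open[of _ _ _ "{..<0}"])
        (use 2 in \<open>auto simp: ramp_def\<close>)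
  next
    case 3
    have "((\<lambda>h. ramp p h / h) \<longlongrightarrow> 0) (at 0)"
    proof (rule Lim_null_comparison[where g="\<lambda>h. ramp (p - 1) h"])
      show "\<forall>\<^sub>F h in at 0. norm (ramp p h / h) \<le> ramp (p - 1) h"
      proof (intro always_eventually allI)
        fix h show "norm (ramp p h / h) \<le> ramp (p - 1) h"
          using powr_add[of h "p - 1" 1] by (cases "h > 0") (auto simp: ramp_def)
      qed
      have "continuous_on UNIV (ramp (p - 1))" using continuous_on_ramp[of "p - 1" UNIV id] assms by simp
      then show "((\<lambda>h. ramp (p - 1) h) \<longlongrightarrow> 0) (at 0)"
        by (simp add: continuous_on_eq_continuous_at isCont_def) (metis ramp_def max.idem powr_zero_eq_one powr_0)
    qed
    then show ?thesis using 3 by (simp add: has_field_derivative_iff ramp_def)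
  qed
qed

section \<open>The obstacle and its convexity\<close>

locale hoelder_exponent =
  fixes \<alpha> :: real
  assumes \<alpha>_pos: "0 < \<alpha>" and \<alpha>_less_1: "\<alpha> < 1"
begin

definition p :: real where "p = 1 + \<alpha>"

text \<open>The p-th power of the distance from the flat range [-1, 1]. Hence \<open>\<Phi>\<close>
  is the p-th power of the l^p distance from the square [-1, 1]^2, and \<open>K\<close> is that
  square thickened by the l^p unit disc.\<close>

definition q :: "real \<Rightarrow> real" where "q t = ramp p (t - 1) + ramp p (- t - 1)"

definition E :: "real \<Rightarrow> real" where "E t = ramp \<alpha> (t - 1) - ramp \<alpha> (- t - 1)"

definition \<Phi> :: "real^2 \<Rightarrow> real" where "\<Phi> y = q (y $ 1) + q (y $ 2)"

text \<open>The square \<open>[- 2, 2]\<^sup>2\<close> with its corners replaced by quarters of \<open>\<l>\<^sup>p\<close> unit discs;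
  the curvature blows up where a flat side meets a corner.\<close>

definition K :: "(real^2) set" where "K = {y. \<Phi> y \<le> 1}"

lemma p_bounds: "1 < p" "p < 2" "p - 1 = \<alpha>"
  using \<alpha>_pos \<alpha>_less_1 by (auto simp: p_def)

lemma q_nonneg: "0 \<le> q t"
  by (simp add: q_def ramp_nonneg)

lemma q_minus [simp]: "q (- t) = q t"
  by (simp add: q_def)

lemma q_abs [simp]: "q \<bar>t\<bar> = q t"
  by (cases "t \<ge> 0") auto

lemma q_ge: "1 \<le> t \<Longrightarrow> q t = (t - 1) powr p"
  by (simp add: q_def ramp_def)

lemma q_le: "t \<le> - 1 \<Longrightarrow> q t = (- t - 1) powr p"
  using q_ge[of "- t"] by simp

lemma q_flat: "\<bar>t\<bar> \<le> 1 \<Longrightarrow> q t = 0"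
  by (simp add: q_def ramp_def)

lemma q_mono: "\<bar>s\<bar> \<le> \<bar>t\<bar> \<Longrightarrow> q s \<le> q t"
proof -
  have "q \<bar>s\<bar> \<le> q \<bar>t\<bar>" if "\<bar>s\<bar> \<le> \<bar>t\<bar>"
    using that p_bounds by (cases "\<bar>s\<bar> \<le> 1") (auto simp: q_flat q_nonneg q_ge powr_mono2 simp del: q_abs)
  then show "\<bar>s\<bar> \<le> \<bar>t\<bar> \<Longrightarrow> q s \<le> q t" by simp
qed

lemma q_strict_mono: "\<bar>s\<bar> < \<bar>t\<bar> \<Longrightarrow> 1 < \<bar>t\<bar> \<Longrightarrow> q s < q t"
proof -
  assume a: "\<bar>s\<bar> < \<bar>t\<bar>" "1 < \<bar>t\<bar>"
  have "q \<bar>s\<bar> < q \<bar>t\<bar>"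
    using a p_bounds by (cases "\<bar>s\<bar> \<le> 1") (auto simp: q_flat q_ge powr_less_mono2 simp del: q_abs)
  then show "q s < q t" by simp
qed

lemma q_2: "q 2 = 1" by (simp add: q_ge)

lemma q_less_1_iff: "q t < 1 \<longleftrightarrow> \<bar>t\<bar> < 2"
  using q_strict_mono[of t 2] q_mono[of 2 t] q_2 by fastforce

lemma q_le_1_iff: "q t \<le> 1 \<longleftrightarrow> \<bar>t\<bar> \<le> 2"
  using q_strict_mono[of 2 t] q_mono[of t 2] q_2 by fastforce

lemma continuous_on_q [continuous_intros]: "continuous_on S f \<Longrightarrow> continuous_on S (\<lambda>x. q (f x))"
  unfolding q_def using p_bounds by (intro continuous_intros) auto

lemma q_has_derivative: "(q has_real_derivative p * E t) (at t)"
  unfolding q_def[abs_def] E_def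
  by (rule derivative_eq_intros DERIV_chain2[OF ramp_has_derivative[OF p_bounds(1)]] refl)+
    (simp add: p_bounds algebra_simps)

lemma convex_on_q: "convex_on UNIV q"
proof (rule convex_on_realI)
  show "(q has_real_derivative p * E t) (at t)" for t by (rule q_has_derivative)
  show "p * E s \<le> p * E t" if "s \<le> t" for s t
    unfolding E_def using \<alpha>_pos p_bounds that by (intro mult_left_mono diff_mono ramp_mono) auto
qed auto

lemma continuous_on_\<Phi>: "continuous_on S \<Phi>"
  unfolding \<Phi>_def[abs_def] by (intro continuous_intros)

text \<open>Some coordinate has positive \<open>q\<close>, hence lies beyond the flat range, where
  \<open>q\<close> grows strictly. So the level 1 is left at once in the radial direction, which
  identifies the interior and the boundary of \<open>K\<close>.\<close>

lemma \<Phi>_expand: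
  assumes "\<Phi> y = 1" "1 < c"
  shows "1 < \<Phi> (c *\<^sub>R y)"
proof -
  have le: "q (y $ i) \<le> q (c * y $ i)" for i
    using assms(2) mult_right_mono[of 1 c "\<bar>y $ i\<bar>"] by (intro q_mono) (simp add: abs_mult)
  obtain i where i: "q (y $ i) > 0"
    using assms(1) q_nonneg[of "y $ 1"] q_nonneg[of "y $ 2"] unfolding \<Phi>_def by (metis add.right_neutral less_eq_real_def zero_neq_one)
  then have "1 < \<bar>y $ i\<bar>" using q_flat[of "y $ i"] by force
  moreover from this have "1 * \<bar>y $ i\<bar> < c * \<bar>y $ i\<bar>"
    using assms(2) by (intro mult_strict_right_mono) auto
  ultimately have "\<bar>y $ i\<bar> < \<bar>c * y $ i\<bar>" "1 < \<bar>c * y $ i\<bar>"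
    using assms(2) unfolding abs_mult by linarith+
  then have "q (y $ i) < q (c * y $ i)" by (rule q_strict_mono)
  then show ?thesis
    using assms(1) le[of 1] le[of 2] exhaust_2[of i] by (auto simp: \<Phi>_def)
qed

lemma closed_K: "closed K"
  unfolding K_def by (intro closed_Collect_le continuous_on_\<Phi> continuous_on_const)

lemma interior_K: "interior K = {y. \<Phi> y < 1}"
proof
  have "open {y. \<Phi> y < 1}"
    by (intro open_Collect_less continuous_on_\<Phi> continuous_on_const)
  then show "{y. \<Phi> y < 1} \<subseteq> interior K"
    by (intro interior_maximal) (auto simp: K_def)
  show "interior K \<subseteq> {y. \<Phi> y < 1}"
  proof
    fix y assume y: "y \<in> interior K"
    then have "\<Phi> y \<le> 1" using interior_subset[of K] by (auto simp: K_def)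
    moreover have "\<Phi> y \<noteq> 1"
    proof
      assume 1: "\<Phi> y = 1"
      have "((\<lambda>c. c *\<^sub>R y) \<longlongrightarrow> 1 *\<^sub>R y) (at_right (1::real))"
        by (intro tendsto_intros)
      then have "\<forall>\<^sub>F c in at_right (1::real). c *\<^sub>R y \<in> interior K"
        using y by (intro topological_tendstoD) auto
      moreover have "\<forall>\<^sub>F c in at_right (1::real). 1 < c"
        by (simp add: eventually_at_filter)
      ultimately have "\<forall>\<^sub>F c in at_right (1::real). False"
        by eventually_elim (use \<Phi>_expand[OF 1] interior_subset[of K] in \<open>force simp: K_def\<close>)
      then show False by simp
    qed
    ultimately show "y \<in> {y. \<Phi> y < 1}" by simp
  qed
qed

lemma frontier_K: "frontier K = {y. \<Phi> y = 1}"
  unfolding frontier_def interior_K closure_closed[OF closed_K] by (auto simp: K_def)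

lemma convex_body_K: "convex_body K"
  unfolding convex_body_def
proof (intro conjI)
  have "bounded K"
  proof (rule boundedI)
    fix y assume "y \<in> K"
    then have "q (y $ 1) \<le> 1" "q (y $ 2) \<le> 1"
      using q_nonneg[of "y $ 1"] q_nonneg[of "y $ 2"] by (auto simp: K_def \<Phi>_def)
    then have "\<bar>y $ 1\<bar> \<le> 2" "\<bar>y $ 2\<bar> \<le> 2" by (auto simp: q_le_1_iff)
    then show "norm y \<le> 4" using norm_le_l1_cart[of y] by (simp add: UNIV_2)
  qed
  then show "compact K" using closed_K by (simp add: compact_eq_bounded_closed)
  show "convex K"
  proof (rule convexI)
    fix x y and u v :: real assume xy: "x \<in> K" "y \<in> K" "0 \<le> u" "0 \<le> v" "u + v = 1"
    have "q (u * s + v * t) \<le> u * q s + v * q t" for s t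
      using convex_on_q xy by (auto simp: convex_on_def)
    from this[of "x $ 1" "y $ 1"] this[of "x $ 2" "y $ 2"]
    have "\<Phi> (u *\<^sub>R x + v *\<^sub>R y) \<le> u * \<Phi> x + v * \<Phi> y" by (simp add: \<Phi>_def algebra_simps)
    also have "\<dots> \<le> u * 1 + v * 1"
      using xy by (intro add_mono mult_left_mono) (auto simp: K_def)
    finally show "u *\<^sub>R x + v *\<^sub>R y \<in> K" using xy by (simp add: K_def)
  qed
  have "0 \<in> interior K" by (simp add: interior_K \<Phi>_def q_flat)
  then show "interior K \<noteq> {}" by auto
qed

section \<open>The lower boundary arc as a graph over the line\<close>

definition \<beta> :: real where "\<beta> = \<alpha> / p"

text \<open>The arc becomes vertical at |t| = 2, so its slope is frozen before that. The bound 7/4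
  is below 2 and satisfies \<open>q (7/4) > 1/2\<close>, so that the graph over (-7/4, 7/4) and its
  symmetric images still cover the boundary.\<close>

definition clamp :: "real \<Rightarrow> real" where "clamp t = max (- 7/4) (min (7/4) t)"

text \<open>Derivative of -1 - (1 - q t)^(1/p): the exponent is 1/p - 1 = -\<beta>, and the factor p
  in q' = p E cancels. The slope comes first, and the graph is recovered by integration.\<close>

definition slope :: "real \<Rightarrow> real" where
  "slope t = E (clamp t) * (1 - q (clamp t)) powr (- \<beta>)"

lemma \<beta>_pos: "0 < \<beta>"
  using \<alpha>_pos p_bounds by (simp add: \<beta>_def)

lemma clamp_eq: "\<bar>t\<bar> \<le> 7/4 \<Longrightarrow> clamp t = t"
  by (auto simp: clamp_def)

lemma clamp_bounds: "\<bar>clamp t\<bar> \<le> 7/4"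
  by (auto simp: clamp_def)

lemma q_less_1: "\<bar>t\<bar> \<le> 7/4 \<Longrightarrow> q t < 1"
  by (simp add: q_less_1_iff)

lemma abs_E_le_1: "\<bar>t\<bar> \<le> 2 \<Longrightarrow> \<bar>E t\<bar> \<le> 1"
proof -
  assume "\<bar>t\<bar> \<le> 2"
  then have "ramp \<alpha> (t - 1) \<le> ramp \<alpha> 1" "ramp \<alpha> (- t - 1) \<le> ramp \<alpha> 1"
    using \<alpha>_pos by (auto intro!: ramp_mono)
  moreover have "ramp \<alpha> 1 = 1" by (simp add: ramp_def)
  ultimately show ?thesis
    using ramp_nonneg[of \<alpha> "t - 1"] ramp_nonneg[of \<alpha> "- t - 1"] by (simp add: E_def abs_le_iff)
qed

lemma E_holder: "\<bar>E x - E y\<bar> \<le> 2 * \<bar>x - y\<bar> powr \<alpha>"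
  using ramp_holder[OF \<alpha>_pos \<alpha>_less_1, of "x - 1" "y - 1"] ramp_holder[OF \<alpha>_pos \<alpha>_less_1, of "- x - 1" "- y - 1"]
  by (simp add: E_def abs_minus_commute)

text \<open>The \<alpha>-Hoelder function \<open>E\<close> is multiplied by a power of
  \<open>1 - q\<close>, which is Lipschitz on [-7/4, 7/4] because \<open>1 - q\<close> stays away
  from 0; \<open>clamp\<close> is 1-Lipschitz and extends the bound to the line.\<close>

lemma slope_holder:
  obtains C where "\<And>x y. \<bar>slope x - slope y\<bar> \<le> C * \<bar>x - y\<bar> powr \<alpha>" "0 \<le> C"
proof -
  let ?I = "{- 7/4..7/4::real}" and ?D = "\<lambda>t. (1 - q t) powr (- \<beta>)"
  let ?D' = "\<lambda>t. \<beta> * (1 - q t) powr (- \<beta> - 1) * (p * E t)"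
  have q1: "q t < 1" if "t \<in> ?I" for t using that by (intro q_less_1) auto
  have contE: "continuous_on S E" for S
    unfolding E_def[abs_def] using \<alpha>_pos by (intro continuous_intros) auto
  have "continuous_on ?I ?D" "continuous_on ?I ?D'"
    using q1 by (intro continuous_intros contE; force)+
  then have "bounded (?D ` ?I)" "bounded (?D' ` ?I)"
    by (auto intro!: compact_imp_bounded compact_continuous_image)
  then obtain M L where M: "\<And>t. t \<in> ?I \<Longrightarrow> \<bar>?D t\<bar> \<le> M" and L: "\<And>t. t \<in> ?I \<Longrightarrow> \<bar>?D' t\<bar> \<le> L"
    unfolding bounded_iff ball_simps real_norm_def by blast
  have L0: "0 \<le> L" "0 \<le> M" using order_trans[OF abs_ge_zero L[of 0]] order_trans[OF abs_ge_zero M[of 0]] by auto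
  have deriv: "(?D has_real_derivative ?D' t) (at t within ?I)" if "t \<in> ?I" for t
    using q1[OF that]
    by (auto intro!: derivative_eq_intros DERIV_subset[OF q_has_derivative] simp: powr_diff)
  have lip: "\<bar>?D x - ?D y\<bar> \<le> L * \<bar>x - y\<bar>" if "x \<in> ?I" "y \<in> ?I" for x y
    using field_differentiable_bound[OF _ deriv, of L x y] L that by auto
  \<comment> \<open>Two points of the interval are at most 7/2 apart, so a Lipschitz bound is an
    \<alpha>-Hoelder bound up to the factor 4.\<close>
  have conv: "\<bar>x - y\<bar> \<le> 4 * \<bar>x - y\<bar> powr \<alpha>" if "x \<in> ?I" "y \<in> ?I" for x y
  proof -
    have "\<bar>x - y\<bar> powr (1 - \<alpha>) \<le> 4 powr (1 - \<alpha>)" using that \<alpha>_less_1 by (intro powr_mono2) auto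
    also have "\<dots> \<le> 4 powr 1" using \<alpha>_pos by (intro powr_mono) auto
    finally have "\<bar>x - y\<bar> powr \<alpha> * \<bar>x - y\<bar> powr (1 - \<alpha>) \<le> \<bar>x - y\<bar> powr \<alpha> * 4"
      by (intro mult_left_mono) auto
    then show ?thesis by (simp add: powr_add[symmetric] mult.commute)
  qed
  have "\<bar>E x * ?D x - E y * ?D y\<bar> \<le> (4 * L + 2 * M) * \<bar>x - y\<bar> powr \<alpha>" if "x \<in> ?I" "y \<in> ?I" for x y
  proof -
    have "E x * ?D x - E y * ?D y = E x * (?D x - ?D y) + (E x - E y) * ?D y" by (simp add: algebra_simps)
    also have "\<bar>\<dots>\<bar> \<le> \<bar>E x\<bar> * \<bar>?D x - ?D y\<bar> + \<bar>E x - E y\<bar> * \<bar>?D y\<bar>"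
      by (rule order_trans[OF abs_triangle_ineq]) (simp add: abs_mult)
    also have "\<dots> \<le> 1 * (L * (4 * \<bar>x - y\<bar> powr \<alpha>)) + (2 * \<bar>x - y\<bar> powr \<alpha>) * M"
    proof (intro add_mono mult_mono)
      show "\<bar>E x\<bar> \<le> 1" using that by (intro abs_E_le_1) auto
      show "\<bar>?D x - ?D y\<bar> \<le> L * (4 * \<bar>x - y\<bar> powr \<alpha>)"
        using lip[OF that] mult_left_mono[OF conv[OF that] L0(1)] by linarith
      show "\<bar>?D y\<bar> \<le> M" using M that by simp
      show "\<bar>E x - E y\<bar> \<le> 2 * \<bar>x - y\<bar> powr \<alpha>" by (rule E_holder)
    qed auto
    finally show ?thesis by (simp add: algebra_simps)
  qed
  note base = this
  show ?thesis
  proof (rule that)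
    fix x y
    have "\<bar>slope x - slope y\<bar> \<le> (4 * L + 2 * M) * \<bar>clamp x - clamp y\<bar> powr \<alpha>"
      unfolding slope_def by (rule base) (auto simp: clamp_def)
    also have "\<dots> \<le> (4 * L + 2 * M) * \<bar>x - y\<bar> powr \<alpha>"
      using L0 \<alpha>_pos by (intro mult_left_mono powr_mono2) (auto simp: clamp_def)
    finally show "\<bar>slope x - slope y\<bar> \<le> (4 * L + 2 * M) * \<bar>x - y\<bar> powr \<alpha>" .
  qed (use L0 in auto)
qed

lemma continuous_on_slope: "continuous_on UNIV slope"
  unfolding slope_def[abs_def] E_def clamp_def
proof (intro continuous_intros ballI)
  show "1 - q (max (- 7 / 4) (min (7 / 4) t)) \<noteq> 0" for t
    using q_less_1[OF clamp_bounds[of t]] by (simp add: clamp_def)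
qed (use \<alpha>_pos in auto)

lemma slope_bounded: obtains B where "\<And>t. \<bar>slope t\<bar> \<le> B"
proof -
  have "bounded (slope ` {- 7/4..7/4})"
    by (intro compact_imp_bounded compact_continuous_image continuous_on_subset[OF continuous_on_slope]) auto
  then obtain B where B: "\<And>t. t \<in> {- 7/4..7/4} \<Longrightarrow> \<bar>slope t\<bar> \<le> B" unfolding bounded_iff ball_simps real_norm_def by blast
  have "\<bar>slope t\<bar> \<le> B" for t
  proof -
    have "slope (clamp t) = slope t" by (simp add: slope_def clamp_eq[OF clamp_bounds])
    moreover have "clamp t \<in> {- 7/4..7/4}" using clamp_bounds[of t] by (auto simp: abs_le_iff)
    ultimately show ?thesis using B by metis
  qed
  then show ?thesis by (rule that)
qed

lemma continuous_antiderivative: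
  fixes f :: "real \<Rightarrow> real"
  assumes "continuous_on UNIV f"
  shows "\<exists>F. F a = b \<and> (\<forall>t. (F has_real_derivative f t) (at t))"
proof -
  have "\<exists>F. \<forall>x :: real. -\<infinity> < ereal x \<longrightarrow> ereal x < \<infinity> \<longrightarrow> (F has_vector_derivative f x) (at x)"
    using assms by (intro einterval_antiderivative) (auto simp: continuous_on_eq_continuous_at)
  then obtain F where "\<And>t. (F has_real_derivative f t) (at t)"
    by (auto simp: has_real_derivative_iff_has_vector_derivative)
  then have "((\<lambda>t. F t + (b - F a)) has_real_derivative f t) (at t)" for t
    by (auto intro!: derivative_eq_intros)
  then show ?thesis by (intro exI[of _ "\<lambda>t. F t + (b - F a)"]) simp
qed

text \<open>A chart requires a graph function on the whole line; as \<open>slope\<close> is constant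
  beyond 7/4, this antiderivative continues the arc by its tangent lines. The value -2 is the height
  of the bottom side.\<close>

definition g :: "real \<Rightarrow> real" where
  "g = (SOME g. g 0 = - 2 \<and> (\<forall>t. (g has_real_derivative slope t) (at t)))"

lemma g_0: "g 0 = - 2" and g_has_derivative: "(g has_real_derivative slope t) (at t)"
  using someI_ex[OF continuous_antiderivative[OF continuous_on_slope, of 0 "- 2"]]
  unfolding g_def by auto

lemma continuous_on_g: "continuous_on S g"
  by (meson g_has_derivative DERIV_isCont continuous_at_imp_continuous_on)

lemma g_eq: "\<bar>t\<bar> \<le> 7/4 \<Longrightarrow> g t = - 1 - (1 - q t) powr (1 / p)"
proof -
  let ?I = "{- 7/4..7/4::real}" and ?h = "\<lambda>t. - 1 - (1 - q t) powr (1 / p)"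
  have e: "1 / p - 1 = - \<beta>" using p_bounds by (simp add: \<beta>_def field_simps)
  have "\<exists>c. \<forall>t\<in>?I. g t - ?h t = c"
  proof (rule has_field_derivative_zero_constant)
    fix t assume t: "t \<in> ?I"
    have "((\<lambda>t. (1 - q t) powr (1 / p)) has_real_derivative
        (1 / p * (1 - q t) powr (1 / p - 1)) * (0 - p * E t)) (at t)"
      using t by (intro DERIV_chain2[where g="\<lambda>t. 1 - q t", OF has_real_derivative_powr] DERIV_diff DERIV_const q_has_derivative)
        (use q_less_1[of t] in auto)
    moreover have ct: "clamp t = t" using t by (intro clamp_eq) auto
    ultimately have "((\<lambda>t. (1 - q t) powr (1 / p)) has_real_derivative - slope t) (at t)"
      using p_bounds ct by (simp add: e slope_def mult.commute)
    from DERIV_diff[OF g_has_derivative DERIV_diff[OF DERIV_const this]]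
    show "((\<lambda>t. g t - ?h t) has_real_derivative 0) (at t within ?I)"
      by (auto intro: DERIV_subset)
  qed auto
  then obtain c where c: "\<And>t. t \<in> ?I \<Longrightarrow> g t - ?h t = c" by auto
  have "c = 0" using c[of 0] by (simp add: g_0 q_flat)
  moreover assume "\<bar>t\<bar> \<le> 7/4"
  then have "t \<in> ?I" by (auto simp: abs_le_iff)
  ultimately show "g t = ?h t" using c[of t] by simp
qed

lemma q_g: "\<bar>t\<bar> \<le> 7/4 \<Longrightarrow> q (g t) = 1 - q t"
proof -
  assume t: "\<bar>t\<bar> \<le> 7/4"
  then have "q (g t) = ((1 - q t) powr (1 / p)) powr p"
    using q_le[of "g t"] by (simp add: g_eq)
  also have "\<dots> = 1 - q t" using p_bounds q_less_1[OF t] by (simp add: powr_powr)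
  finally show ?thesis .
qed

section \<open>Charts of the boundary\<close>

definition window :: "(real^2) set" where "window = {y. \<bar>y $ 1\<bar> < 7/4 \<and> y $ 2 < - 1}"

text \<open>Below height -1 the function \<open>q\<close> is a strictly monotone power, so the
  boundary equation can be solved for the second coordinate.\<close>

lemma window_graph:
  assumes "y \<in> window" shows "\<Phi> y = 1 \<longleftrightarrow> y $ 2 = g (y $ 1)"
proof -
  have y: "\<bar>y $ 1\<bar> \<le> 7/4" "y $ 2 < - 1" using assms by (auto simp: window_def)
  show ?thesis
  proof
    assume "\<Phi> y = 1"
    then have "1 - q (y $ 1) = (- (y $ 2) - 1) powr p" using y by (simp add: \<Phi>_def q_le)
    then have "(1 - q (y $ 1)) powr (1 / p) = - (y $ 2) - 1"
      using y p_bounds by (simp add: powr_powr)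
    then show "y $ 2 = g (y $ 1)" using y by (simp add: g_eq)
  next
    assume "y $ 2 = g (y $ 1)"
    then show "\<Phi> y = 1" using q_g[OF y(1)] by (simp add: \<Phi>_def)
  qed
qed

lemma C1_holder_g: "C1_holder \<alpha> UNIV g"
proof -
  obtain C where C: "\<And>x y. \<bar>slope x - slope y\<bar> \<le> C * \<bar>x - y\<bar> powr \<alpha>" using slope_holder by metis
  define D where "D t = slope t *\<^sub>R (id_blinfun :: real \<Rightarrow>\<^sub>L real)" for t
  have "dist (D x) (D y) \<le> C * dist x y powr \<alpha>" for x y
  proof -
    have "dist (D x) (D y) = \<bar>slope x - slope y\<bar>"
      by (simp add: D_def dist_norm scaleR_left_diff_distrib[symmetric])
    then show ?thesis using C by (simp add: dist_real_def)
  qed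
  then have "holder_on \<alpha> UNIV D" by (auto simp: holder_on_def)
  moreover have "continuous_on UNIV D"
    unfolding D_def[abs_def] by (intro continuous_intros continuous_on_slope)
  moreover have "(g has_derivative blinfun_apply (D t)) (at t)" for t
  proof -
    have "blinfun_apply (D t) = (*) (slope t)" by (simp add: D_def fun_eq_iff scaleR_blinfun.rep_eq)
    then show ?thesis using g_has_derivative[of t] by (simp add: has_field_derivative_def)
  qed
  ultimately show ?thesis by (auto simp: C1_holder_def continuous_on_g)
qed

text \<open>A single graph serves the whole boundary: a symmetry of \<open>\<Phi>\<close> that moves
  the point into the bottom window gives the chart, with the preimage of the window as
  neighbourhood.\<close>

lemma chart:
  assumes R: "orthogonal_transformation R" "\<And>y. \<Phi> (R y) = \<Phi> y" and P: "R P \<in> window"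
  shows "\<exists>T U (g :: real \<Rightarrow> real). rigid_motion T \<and> open U \<and> P \<in> U \<and> C1_holder \<alpha> UNIV g \<and>
      T ` (frontier K \<inter> U) = {y \<in> T ` U. y $ 2 = g (y $ 1)}"
proof (intro exI conjI)
  have "rigid_motion (\<lambda>x. 0 + R x)" unfolding rigid_motion_def using R(1) by blast
  then show "rigid_motion R" by simp
  have "open window"
    unfolding window_def by (intro open_Collect_conj open_Collect_less continuous_intros)
  moreover have "continuous_on UNIV R"
    using R(1) by (intro linear_continuous_on) (simp add: orthogonal_transformation_linear linear_conv_bounded_linear[symmetric])
  ultimately show "open (R -` window)" by (rule open_vimage)
  show "P \<in> R -` window" using P by simp
  show "C1_holder \<alpha> UNIV g" by (rule C1_holder_g)
  have surj: "R ` (R -` A) = A" for A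
    using orthogonal_transformation_surj[OF R(1)] by (simp add: surj_image_vimage_eq)
  have "R ` (frontier K \<inter> R -` window) = {y \<in> window. \<Phi> y = 1}"
  proof -
    have "frontier K \<inter> R -` window = R -` {y \<in> window. \<Phi> y = 1}"
      using R(2) by (auto simp: frontier_K)
    then show ?thesis by (simp only: surj)
  qed
  then show "R ` (frontier K \<inter> R -` window) = {y \<in> R ` (R -` window). y $ 2 = g (y $ 1)}"
    unfolding surj using window_graph by auto
qed

lemma orthogonal_transformation_signed_swap:
  fixes s :: real
  assumes "\<bar>s\<bar> = 1"
  shows "orthogonal_transformation (\<lambda>y::real^2. vector [y $ 1, s * y $ 2] :: real^2)"
    and "orthogonal_transformation (\<lambda>y::real^2. vector [y $ 2, s * y $ 1] :: real^2)"
proof -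
  have ss: "s * s = 1" using assms by (metis abs_mult_self_eq mult_1)
  then have s: "s * a * (s * b) = a * b" for a b using ss by (simp add: mult.left_commute mult.assoc[symmetric])
  show "orthogonal_transformation (\<lambda>y::real^2. vector [y $ 1, s * y $ 2] :: real^2)"
    "orthogonal_transformation (\<lambda>y::real^2. vector [y $ 2, s * y $ 1] :: real^2)"
    by (auto simp: orthogonal_transformation_def inner_vec_def sum_2 s ss vec_eq_iff forall_2 algebra_simps intro!: linearI)
qed

text \<open>The values of \<open>q\<close> at the two coordinates add up to 1. A coordinate with
  value at most 1/2 stays within 7/4, and the other lies beyond the flat range; a reflection,
  combined with a swap if necessary, makes the latter a negative second coordinate.\<close>

lemma C1_holder_boundary_K: "C1_holder_boundary \<alpha> K"
  unfolding C1_holder_boundary_def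
proof
  fix P assume "P \<in> frontier K"
  then have P: "q (P $ 1) + q (P $ 2) = 1" by (simp add: frontier_K \<Phi>_def)
  have small: "\<bar>t\<bar> < 7/4" if "q t \<le> 1/2" for t
  proof (rule ccontr)
    assume "\<not> \<bar>t\<bar> < 7/4"
    then have "q (7/4) \<le> q t" by (intro q_mono) auto
    \<comment> \<open>Here p < 2 is used; the right-hand side is 9/16, which exceeds 1/2.\<close>
    moreover have "q (7/4) \<ge> (3/4) powr 2"
      using p_bounds powr_mono'[of p 2 "3/4"] by (simp add: q_ge)
    ultimately show False using that by (simp add: power2_eq_square)
  qed
  have large: "1 < \<bar>t\<bar>" if "q t \<ge> 1/2" for t
    using q_flat[of t] that by force
  define s where "s t = (if t < 0 then 1 else - 1 :: real)" for t :: real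
  have s: "\<bar>s t\<bar> = 1" "s t * t = - \<bar>t\<bar>" "q (s t * a) = q a" for t a by (auto simp: s_def)
  show "\<exists>T U (g :: real \<Rightarrow> real). rigid_motion T \<and> open U \<and> P \<in> U \<and> C1_holder \<alpha> UNIV g \<and>
      T ` (frontier K \<inter> U) = {y \<in> T ` U. y $ 2 = g (y $ 1)}"
  proof (cases "q (P $ 1) \<le> 1/2")
    case True
    show ?thesis
      by (rule chart[OF orthogonal_transformation_signed_swap(1)[OF s(1)[of "P $ 2"]]])
        (use True P small[of "P $ 1"] large[of "P $ 2"] in \<open>auto simp: \<Phi>_def s window_def\<close>)
  next
    case False
    show ?thesis
      by (rule chart[OF orthogonal_transformation_signed_swap(2)[OF s(1)[of "P $ 1"]]])
        (use False P small[of "P $ 2"] large[of "P $ 1"] in \<open>auto simp: \<Phi>_def s window_def\<close>)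
  qed
qed

end

text \<open>A chart-free consequence of C^{1,1} regularity, so that it can be refuted for all charts
  at once. The Lipschitz derivative of the graph function gives a quadratic Taylor remainder, and
  rigid motions preserve lengths and inner products of differences.\<close>

lemma C1_lipschitz_boundary_tangent:
  fixes S :: "(real^2) set"
  assumes "C1_holder_boundary 1 S" "P \<in> frontier S"
  obtains \<nu> C U where "\<nu> \<noteq> 0" "open U" "P \<in> U"
    "\<And>Q. Q \<in> frontier S \<inter> U \<Longrightarrow> \<bar>(Q - P) \<bullet> \<nu>\<bar> \<le> C * (norm (Q - P))\<^sup>2"
proof -
  obtain T U and h :: "real \<Rightarrow> real" where T: "rigid_motion T" and U: "open U" "P \<in> U"
    and h: "C1_holder 1 UNIV h" and graph: "T ` (frontier S \<inter> U) = {y \<in> T ` U. y $ 2 = h (y $ 1)}"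
    using assms unfolding C1_holder_boundary_def by blast
  obtain R a where R: "orthogonal_transformation R" and T_eq: "T = (\<lambda>x. a + R x)"
    using T by (auto simp: rigid_motion_def)
  obtain h' where h': "\<And>x. (h has_derivative blinfun_apply (h' x)) (at x)" "holder_on 1 UNIV h'"
    using h unfolding C1_holder_def by auto
  then obtain C where C: "\<And>x y. dist (h' x) (h' y) \<le> C * dist x y"
    by (auto simp: holder_on_def)
  have C0: "0 \<le> C" using order_trans[OF zero_le_dist C[of 0 1]] by simp
  have conth: "continuous_on A h" for A
    by (meson h'(1) continuous_at_imp_continuous_on has_derivative_continuous)
  have taylor: "\<bar>h x - h z - h' z (x - z)\<bar> \<le> C * (x - z)\<^sup>2" for x z
  proof -
    obtain t where t: "t \<in> closed_segment z x" "h x - h z = h' t (x - z)"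
    proof (rule linorder_cases[of x z])
      assume "x < z"
      then obtain t where "x < t" "t < z" "h z - h x = h' t (z - x)"
        by (rule mvt[OF _ conth h'(1)])
      then show ?thesis
        using that[of t] blinfun.minus_right[of "h' t" "z - x"] by (auto simp: closed_segment_eq_real_ivl)
    next
      assume "z < x"
      then obtain t where "z < t" "t < x" "h x - h z = h' t (x - z)"
        by (rule mvt[OF _ conth h'(1)])
      then show ?thesis using that[of t] by (auto simp: closed_segment_eq_real_ivl)
    qed (use that[of z] in \<open>auto simp: blinfun.zero_right\<close>)
    have "\<bar>h x - h z - h' z (x - z)\<bar> = norm ((h' t - h' z) (x - z))"
      by (simp add: t blinfun.diff_left)
    also have "\<dots> \<le> norm (h' t - h' z) * norm (x - z)" by (rule norm_blinfun)
    also have "\<dots> \<le> (C * \<bar>x - z\<bar>) * \<bar>x - z\<bar>"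
    proof (intro mult_mono)
      have "norm (h' t - h' z) \<le> C * \<bar>t - z\<bar>" using C[of t z] by (simp add: dist_norm)
      also have "\<dots> \<le> C * \<bar>x - z\<bar>"
        using t(1) C0 by (intro mult_left_mono) (auto simp: closed_segment_eq_real_ivl split: if_splits)
      finally show "norm (h' t - h' z) \<le> C * \<bar>x - z\<bar>" .
    qed (use C0 in auto)
    finally show ?thesis by (simp add: power2_eq_square abs_mult_self_eq mult.assoc)
  qed
  define z where "z = T P"
  \<comment> \<open>The upward normal of the graph at \<open>z\<close>; \<open>\<nu>\<close> is its
    preimage under the linear part \<open>R\<close> of the motion.\<close>
  define n :: "real^2" where "n = vector [- h' (z $ 1) 1, 1]"
  obtain \<nu> where \<nu>: "R \<nu> = n" using orthogonal_transformation_surj[OF R] by (metis surjD)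
  have lin: "linear R" using R by (rule orthogonal_transformation_linear)
  show ?thesis
  proof (rule that)
    have "n $ 2 = 1" by (simp add: n_def)
    then show "\<nu> \<noteq> 0" using \<nu> linear_0[OF lin] by auto
    show "open U" "P \<in> U" using U by auto
    have z: "z $ 2 = h (z $ 1)" using graph assms(2) U(2) unfolding z_def by blast
    fix Q assume Q: "Q \<in> frontier S \<inter> U"
    define w where "w = T Q"
    have w: "w $ 2 = h (w $ 1)" using graph Q unfolding w_def by blast
    have wz: "w - z = R (Q - P)" by (simp add: w_def z_def T_eq linear_diff[OF lin])
    have "(Q - P) \<bullet> \<nu> = (w - z) \<bullet> n"
      using R by (simp add: wz \<nu>[symmetric] orthogonal_transformation_def)
    also have "\<dots> = h (w $ 1) - h (z $ 1) - h' (z $ 1) (w $ 1 - z $ 1)"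
      using blinfun.scaleR_right[of "h' (z $ 1)" "w $ 1 - z $ 1" 1]
      by (simp add: inner_vec_def sum_2 n_def w z algebra_simps)
    finally have "\<bar>(Q - P) \<bullet> \<nu>\<bar> \<le> C * (w $ 1 - z $ 1)\<^sup>2" using taylor by simp
    also have "\<dots> \<le> C * (norm (w - z))\<^sup>2"
      using C0 component_le_norm_cart[of "w - z" 1] by (intro mult_left_mono) (auto simp: abs_le_square_iff[symmetric])
    also have "norm (w - z) = norm (Q - P)"
      using R wz by (simp add: orthogonal_transformation_norm)
    finally show "\<bar>(Q - P) \<bullet> \<nu>\<bar> \<le> C * (norm (Q - P))\<^sup>2" .
  qed
qed

context hoelder_exponent
begin

text \<open>At the junction (1, -2) the boundary is horizontal on the left, so a normal with
  quadratic contact must be vertical. On the right it rises like the p-th power of the distance with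
  p < 2, too fast for quadratic contact unless the normal is zero.\<close>

lemma not_C11_boundary_K: "\<not> C1_holder_boundary 1 K"
proof
  assume C11: "C1_holder_boundary 1 K"
  define P :: "real^2" where "P = vector [1, - 2]"
  have P: "P \<in> frontier K" by (simp add: P_def frontier_K \<Phi>_def q_flat q_2)
  obtain \<nu> C U where \<nu>: "\<nu> \<noteq> 0" and U: "open U" "P \<in> U"
    and tan: "\<And>Q. Q \<in> frontier K \<inter> U \<Longrightarrow> \<bar>(Q - P) \<bullet> \<nu>\<bar> \<le> C * (norm (Q - P))\<^sup>2"
    using C1_lipschitz_boundary_tangent[OF C11 P] by metis
  define Q :: "real \<Rightarrow> real^2" where "Q t = vector [t, g t]" for t
  have Q1: "Q 1 = P" by (simp add: Q_def P_def g_eq q_flat)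
  have Qf: "Q t \<in> frontier K" if "\<bar>t\<bar> \<le> 7/4" for t
    using q_g[OF that] by (simp add: Q_def frontier_K \<Phi>_def)
  have "Q = (\<lambda>t. \<chi> i. if i = 1 then t else g t)"
    by (simp add: Q_def fun_eq_iff vec_eq_iff forall_2)
  moreover have "continuous_on UNIV (\<lambda>t. if i = 1 then t else g t)" for i :: 2
    by (cases "i = 1") (auto simp: continuous_on_g)
  ultimately have "continuous_on UNIV Q"
    by (simp add: continuous_on_vec_lambda)
  then have QU: "open (Q -` U)" using U(1) by (intro open_vimage)
  have "1 \<in> Q -` U" using Q1 U(2) by simp
  then obtain e where e: "0 < e" "ball 1 e \<subseteq> Q -` U" using QU open_contains_ball by blast
  \<comment> \<open>The bound 3/4 keeps \<open>t\<close> below 1 + 3/4 = 7/4, where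
    \<open>Q t\<close> is on the boundary.\<close>
  define r where "r = min e (3/4)"
  have r: "0 < r" using e by (simp add: r_def)
  have T: "\<bar>(Q t - P) \<bullet> \<nu>\<bar> \<le> C * (norm (Q t - P))\<^sup>2" if "\<bar>t - 1\<bar> < r" for t
  proof (rule tan)
    have "t \<in> ball 1 e" using that by (auto simp: r_def dist_real_def)
    moreover have "\<bar>t\<bar> \<le> 7/4" using that unfolding r_def by linarith
    ultimately show "Q t \<in> frontier K \<inter> U" using e Qf[of t] by auto
  qed
  have left: "\<bar>\<nu> $ 1\<bar> \<le> C * x" if "0 < x" "x < r" for x
  proof -
    have "Q (1 - x) - P = vector [- x, 0]"
      using that by (simp add: Q_def P_def g_eq q_flat r_def vec_eq_iff forall_2)
    moreover have "(norm (vector [- x, 0] :: real^2))\<^sup>2 = x * x"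
      by (simp add: power2_norm_eq_inner inner_vec_def sum_2)
    ultimately have "\<bar>x * \<nu> $ 1\<bar> \<le> C * (x * x)"
      using T[of "1 - x"] that by (simp add: inner_vec_def sum_2)
    then have "x * \<bar>\<nu> $ 1\<bar> \<le> x * (C * x)" using that by (simp add: abs_mult algebra_simps)
    then show ?thesis using that by (simp only: mult_le_cancel_left_pos)
  qed
  have "\<bar>\<nu> $ 1\<bar> \<le> 0"
  proof (rule tendsto_lowerbound)
    show "((\<lambda>x. C * x) \<longlongrightarrow> 0) (at_right 0)"
      by (intro tendsto_mult_right_zero tendsto_ident_at)
    show "\<forall>\<^sub>F x in at_right 0. \<bar>\<nu> $ 1\<bar> \<le> C * x"
      using left r by (auto simp: eventually_at_right_field)
  qed simp
  then have \<nu>1: "\<nu> $ 1 = 0" by simp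
  have "0 \<le> C * (r/2)" using order_trans[OF abs_ge_zero left[of "r/2"]] r by simp
  then have C0: "0 \<le> C" using r by (simp add: zero_le_mult_iff)
  have right: "\<bar>\<nu> $ 2\<bar> \<le> 4 * C * x powr (2 - p)" if x: "0 < x" "x < r" for x
  proof -
    \<comment> \<open>\<open>y\<close> is the height of the arc above its tangent at horizontal
      distance \<open>x\<close>. It satisfies x^p / 2 <= y <= x: the lower bound comes from (1 -
      y)^p >= (1 - y)^2 >= 1 - 2 y, the upper one from (1 - x)^p <= 1 - x <= 1 - x^p.\<close>
    define y where "y = 1 - (1 - x powr p) powr (1 / p)"
    have x1: "x < 3/4" using x by (simp add: r_def)
    have xp: "x powr p \<le> x" using powr_mono'[of 1 p x] x x1 p_bounds by simp
    have h: "(1 - y) powr p = 1 - x powr p"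
      using xp x1 p_bounds by (simp add: y_def powr_powr)
    have "(1 - x powr p) powr (1 / p) \<le> 1"
      using xp x1 p_bounds by (intro powr_le1) auto
    then have y0: "0 \<le> y" "y \<le> 1" by (auto simp: y_def)
    have "(1 - y) powr 2 \<le> (1 - y) powr p" using y0 p_bounds by (intro powr_mono') auto
    then have "x powr p \<le> 2 * y" using h y0 by (simp add: power2_eq_square algebra_simps) (smt (verit) mult_nonneg_nonneg)
    have "(1 - x) powr p \<le> 1 - x" using powr_mono'[of 1 p "1 - x"] x x1 p_bounds by simp
    then have "((1 - x) powr p) powr (1 / p) \<le> (1 - x powr p) powr (1 / p)"
      using xp p_bounds by (intro powr_mono2) auto
    then have yx: "y \<le> x" using p_bounds x1 by (simp add: y_def powr_powr)
    have "Q (1 + x) - P = vector [x, y]"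
      using x x1 by (simp add: Q_def P_def g_eq q_ge y_def vec_eq_iff forall_2)
    moreover have "(norm (vector [x, y] :: real^2))\<^sup>2 = x * x + y * y"
      by (simp add: power2_norm_eq_inner inner_vec_def sum_2)
    ultimately have "\<bar>y * \<nu> $ 2\<bar> \<le> C * (x * x + y * y)"
      using T[of "1 + x"] x by (simp add: inner_vec_def sum_2 \<nu>1)
    also have "\<dots> \<le> C * (x * x + x * x)"
      using C0 y0 yx by (intro mult_left_mono add_mono mult_mono) auto
    finally have "y * \<bar>\<nu> $ 2\<bar> \<le> 2 * C * (x * x)" using y0 by (simp add: abs_mult)
    moreover have "x powr p * \<bar>\<nu> $ 2\<bar> \<le> 2 * y * \<bar>\<nu> $ 2\<bar>"
      using \<open>x powr p \<le> 2 * y\<close> by (intro mult_right_mono) auto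
    ultimately have "x powr p * \<bar>\<nu> $ 2\<bar> \<le> 4 * C * (x * x)" by linarith
    also have "x * x = x powr p * x powr (2 - p)"
      using x by (simp add: powr_add[symmetric] power2_eq_square)
    finally have "x powr p * \<bar>\<nu> $ 2\<bar> \<le> x powr p * (4 * C * x powr (2 - p))" by (simp add: algebra_simps)
    then show ?thesis using x by (subst (asm) mult_le_cancel_left_pos) auto
  qed
  have "\<bar>\<nu> $ 2\<bar> \<le> 0"
  proof (rule tendsto_lowerbound)
    \<comment> \<open>\<open>ramp\<close> agrees with \<open>powr\<close> for positive arguments and
      is continuous on the whole line, which gives the limit at 0.\<close>
    have "((\<lambda>x. 4 * C * ramp (2 - p) x) \<longlongrightarrow> 4 * C * ramp (2 - p) 0) (at_right 0)"
      using continuous_on_ramp[of "2 - p" UNIV id] p_bounds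
      by (intro tendsto_mult tendsto_const) (auto simp: continuous_on_def intro: tendsto_within_subset)
    then show "((\<lambda>x. 4 * C * ramp (2 - p) x) \<longlongrightarrow> 0) (at_right 0)" by (simp add: ramp_def)
    show "\<forall>\<^sub>F x in at_right 0. \<bar>\<nu> $ 2\<bar> \<le> 4 * C * ramp (2 - p) x"
      using right r by (auto simp: eventually_at_right_field ramp_def)
  qed simp
  then have "\<nu> = 0" using \<nu>1 by (simp add: vec_eq_iff forall_2)
  then show False using \<nu> by simp
qed

end

subsection \<open>The boundary curve\<close>

lemma holder_on_continuous:
  assumes "holder_on \<alpha> S f" "0 < \<alpha>"
  shows "continuous_on S f"
  unfolding continuous_on_def
proof
  fix x assume x: "x \<in> S"
  obtain C where C: "\<And>x y. x \<in> S \<Longrightarrow> y \<in> S \<Longrightarrow> dist (f x) (f y) \<le> C * dist x y powr \<alpha>"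
    using assms by (auto simp: holder_on_def)
  have "((\<lambda>y. C * dist y x powr \<alpha>) \<longlongrightarrow> C * dist x x powr \<alpha>) (at x within S)"
    using assms(2) by (intro tendsto_intros tendsto_powr') auto
  then have lim: "((\<lambda>y. C * dist y x powr \<alpha>) \<longlongrightarrow> 0) (at x within S)" by simp
  show "(f \<longlongrightarrow> f x) (at x within S)"
  proof (rule tendsto_dist_iff[THEN iffD2], rule tendsto_sandwich[OF _ _ tendsto_const lim])
    show "\<forall>\<^sub>F y in at x within S. dist (f y) (f x) \<le> C * dist y x powr \<alpha>"
      using C x by (simp add: eventually_at_filter)
  qed simp
qed

text \<open>Near a boundary point the ball lies above its lower hemisphere when the inner normal
  \<open>e\<close> is taken as the vertical direction.\<close>

lemma bounded_lipschitz_domain_ball: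
  fixes r :: real
  assumes r: "0 < r"
  shows "bounded_lipschitz_domain (ball (0::'a::euclidean_space) r)"
  unfolding bounded_lipschitz_domain_def
proof (intro conjI ballI)
  show "ball (0::'a) r \<noteq> {}" using r by simp
  fix P :: 'a assume "P \<in> frontier (ball 0 r)"
  then have P: "norm P = r" using r by simp
  define e where "e = - (1 / r) *\<^sub>R P"
  \<comment> \<open>The hemisphere is not Lipschitz up to its equator, and the graph function must
    be Lipschitz on the entire hyperplane. Capping the radius at r/2 keeps the slope below 1 and
    changes nothing over the ball of radius r/2 around \<open>P\<close>.\<close>
  define h where "h y = - sqrt (r\<^sup>2 - (min (norm y) (r/2))\<^sup>2)" for y :: 'a
  have e: "norm e = 1" "P = - r *\<^sub>R e" using P r by (auto simp: e_def)
  have "1-lipschitz_on {y. y \<bullet> e = 0} h"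
  proof (rule lipschitz_onI)
    fix y z :: 'a
    define a b where "a = min (norm y) (r/2)" and "b = min (norm z) (r/2)"
    have ab: "0 \<le> a" "a \<le> r/2" "0 \<le> b" "b \<le> r/2" using r by (auto simp: a_def b_def)
    have low: "r/2 \<le> sqrt (r\<^sup>2 - t\<^sup>2)" if "0 \<le> t" "t \<le> r/2" for t
    proof (rule real_le_rsqrt)
      have "t\<^sup>2 \<le> (r/2)\<^sup>2" using that by (intro power_mono) auto
      moreover have "(r/2)\<^sup>2 = r\<^sup>2 / 4" by (simp add: power_divide)
      ultimately show "(r/2)\<^sup>2 \<le> r\<^sup>2 - t\<^sup>2" using zero_le_power2[of r] by linarith
    qed
    let ?A = "sqrt (r\<^sup>2 - a\<^sup>2)" and ?B = "sqrt (r\<^sup>2 - b\<^sup>2)"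
    have sq: "?A\<^sup>2 = r\<^sup>2 - a\<^sup>2" "?B\<^sup>2 = r\<^sup>2 - b\<^sup>2"
      using ab power_mono[of a r 2] power_mono[of b r 2] by auto
    have "\<bar>?A - ?B\<bar> * (?A + ?B) = \<bar>(?A - ?B) * (?A + ?B)\<bar>"
      using low[OF ab(1,2)] low[OF ab(3,4)] r by (simp add: abs_mult)
    also have "(?A - ?B) * (?A + ?B) = (b - a) * (b + a)"
      using sq by (simp add: power2_eq_square algebra_simps)
    also have "\<bar>(b - a) * (b + a)\<bar> = \<bar>b - a\<bar> * (b + a)" using ab by (simp add: abs_mult)
    also have "\<dots> \<le> \<bar>b - a\<bar> * (?A + ?B)"
      using low[OF ab(1,2)] low[OF ab(3,4)] ab by (intro mult_left_mono) auto
    finally have "\<bar>?A - ?B\<bar> \<le> \<bar>b - a\<bar>"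
      using low[OF ab(1,2)] low[OF ab(3,4)] r by (simp add: mult_le_cancel_right)
    also have "\<dots> \<le> \<bar>norm y - norm z\<bar>" by (auto simp: a_def b_def)
    also have "\<dots> \<le> norm (y - z)" by (rule norm_triangle_ineq3)
    finally show "dist (h y) (h z) \<le> 1 * dist y z"
      by (simp add: h_def a_def b_def dist_norm abs_minus_commute)
  qed simp
  moreover have "ball 0 r \<inter> ball P (r/2) = {x \<in> ball P (r/2). x \<bullet> e > h (x - (x \<bullet> e) *\<^sub>R e)}"
  proof -
    have "norm x < r \<longleftrightarrow> x \<bullet> e > h (x - (x \<bullet> e) *\<^sub>R e)" if "x \<in> ball P (r/2)" for x
    proof -
      define s where "s = x \<bullet> e"
      define y where "y = x - s *\<^sub>R e"
      have ye: "y \<bullet> e = 0" using e(1) by (simp add: y_def s_def inner_diff_left dot_square_norm)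
      have pyth: "(norm (y + t *\<^sub>R e))\<^sup>2 = (norm y)\<^sup>2 + t\<^sup>2" for t
        using e(1) ye norm_add_Pythagorean[of y "t *\<^sub>R e"] by (simp add: orthogonal_def)
      have xP: "x - P = y + (s + r) *\<^sub>R e" by (simp add: y_def e(2) algebra_simps)
      have "norm (x - P) < r/2" using that by (simp add: dist_norm norm_minus_commute)
      then have "(norm (x - P))\<^sup>2 < (r/2)\<^sup>2" by (rule power_strict_mono) auto
      then have "(norm y)\<^sup>2 + (s + r)\<^sup>2 < (r/2)\<^sup>2" unfolding xP pyth .
      then have "(norm y)\<^sup>2 < (r/2)\<^sup>2" "(s + r)\<^sup>2 < (r/2)\<^sup>2"
        using zero_le_power2[of "norm y"] zero_le_power2[of "s + r"] by linarith+
      then have y: "norm y < r/2" and s: "\<bar>s + r\<bar> < r/2"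
        using r power2_less_imp_less[of "norm y" "r/2"] power2_less_imp_less[of "\<bar>s + r\<bar>" "r/2"] by auto
      have "s < 0" using s r by linarith
      have "norm x < r \<longleftrightarrow> (norm x)\<^sup>2 < r\<^sup>2"
        using r by (auto intro: power_strict_mono power2_less_imp_less)
      also have "\<dots> \<longleftrightarrow> s\<^sup>2 < r\<^sup>2 - (norm y)\<^sup>2"
        using pyth[of s] by (auto simp: y_def)
      also have "\<dots> \<longleftrightarrow> \<bar>s\<bar> < sqrt (r\<^sup>2 - (norm y)\<^sup>2)"
        by (metis real_sqrt_abs real_sqrt_less_iff)
      also have "\<dots> \<longleftrightarrow> s > h y"
        using y \<open>s < 0\<close> by (auto simp: h_def)
      finally show ?thesis by (simp add: y_def s_def)
    qed
    then show ?thesis by auto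
  qed
  ultimately show "\<exists>e s L g. norm e = 1 \<and> s > 0 \<and> L-lipschitz_on {y. y \<bullet> e = 0} (g :: 'a \<Rightarrow> real) \<and>
      ball 0 r \<inter> ball P s = {x \<in> ball P s. x \<bullet> e > g (x - (x \<bullet> e) *\<^sub>R e)}"
    using e(1) r by (intro exI[of _ e] exI[of _ "r/2"] exI[of _ 1] exI[of _ h]) auto
qed auto

text \<open>Passes Hoelder continuity from the slope to the unit tangent. The denominator is the
  length of the vector (1, m), so it is at least 1 and changes no faster than m.\<close>

lemma unit_tangent_lipschitz:
  fixes m n :: real
  shows "\<bar>1 / sqrt (1 + m\<^sup>2) - 1 / sqrt (1 + n\<^sup>2)\<bar> \<le> \<bar>m - n\<bar>"
    and "\<bar>m / sqrt (1 + m\<^sup>2) - n / sqrt (1 + n\<^sup>2)\<bar> \<le> 2 * \<bar>m - n\<bar>"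
proof -
  define R where "R t = sqrt (1 + t\<^sup>2)" for t :: real
  have R1: "1 \<le> R t" "\<bar>t\<bar> \<le> R t" for t by (auto simp: R_def real_le_rsqrt)
  have Rle: "R t \<le> R s + \<bar>t - s\<bar>" for s t
    using real_sqrt_sum_squares_triangle_ineq[of 1 0 s "t - s"] by (simp add: R_def)
  have diff: "\<bar>R n - R m\<bar> \<le> \<bar>m - n\<bar>" using Rle[of n m] Rle[of m n] by linarith
  have inv: "\<bar>1 / R m - 1 / R n\<bar> = \<bar>R n - R m\<bar> / (R m * R n)"
    using R1[of m] R1[of n] by (simp add: diff_divide_eq_iff divide_diff_eq_iff abs_mult abs_divide)
  have "1 * 1 \<le> R m * R n" using R1 by (intro mult_mono) (auto intro: order_trans[OF zero_le_one])
  then have "\<bar>R n - R m\<bar> / (R m * R n) \<le> \<bar>R n - R m\<bar> / 1" by (intro divide_left_mono) auto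
  then show "\<bar>1 / sqrt (1 + m\<^sup>2) - 1 / sqrt (1 + n\<^sup>2)\<bar> \<le> \<bar>m - n\<bar>"
    using inv diff by (simp add: R_def)
  have "m / R m - n / R n = (m - n) / R m + n * (1 / R m - 1 / R n)" by (simp add: diff_divide_distrib right_diff_distrib)
  also have "\<bar>\<dots>\<bar> \<le> \<bar>m - n\<bar> / R m + \<bar>n\<bar> * (\<bar>R n - R m\<bar> / (R m * R n))"
    using R1[of m] by (intro order_trans[OF abs_triangle_ineq]) (simp add: abs_mult inv)
  also have "\<dots> \<le> \<bar>m - n\<bar> / 1 + R n * (\<bar>m - n\<bar> / (1 * R n))"
    using R1[of m] R1[of n] diff by (intro add_mono mult_mono frac_le mult_pos_pos) auto
  also have "\<dots> = 2 * \<bar>m - n\<bar>" using R1[of n] by simp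
  finally show "\<bar>m / sqrt (1 + m\<^sup>2) - n / sqrt (1 + n\<^sup>2)\<bar> \<le> 2 * \<bar>m - n\<bar>" by (simp add: R_def)
qed

context hoelder_exponent
begin

text \<open>
  Cosine of the tangent angle of the rounded corner as a function of one coordinate; by the
  symmetry of the corner the sine is the same function of the other coordinate. Hence the sum
  of the antiderivatives in both variables has unit gradient tangent to the corner, and since
  the function decreases in the distance from the axis, the gradient is shorter off \<open>K\<close>.
\<close>

definition cosine :: "real \<Rightarrow> real" where
  "cosine t = max 0 (1 - q t) powr \<beta> / sqrt ((max 0 (1 - q t) powr \<beta>)\<^sup>2 + (q t powr \<beta>)\<^sup>2)"

text \<open>Either \<open>q t < 1\<close> or \<open>q t\<close> is at least 1, so one of the
  summands is positive; this makes \<open>cosine\<close> continuous on the whole line.\<close>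

lemma cosine_denominator: "0 < (max 0 (1 - q t) powr \<beta>)\<^sup>2 + (q t powr \<beta>)\<^sup>2"
proof (cases "q t < 1")
  case True then show ?thesis by (intro add_pos_nonneg) auto
next
  case False then show ?thesis by (intro add_nonneg_pos) auto
qed

lemma continuous_on_cosine [continuous_intros]:
  "continuous_on S f \<Longrightarrow> continuous_on S (\<lambda>x. cosine (f x))"
  unfolding cosine_def using \<beta>_pos q_nonneg cosine_denominator
  by (intro continuous_on_divide continuous_on_real_sqrt continuous_on_add continuous_on_power continuous_on_powr'
      continuous_on_max continuous_on_diff continuous_on_q continuous_on_const)
    (auto simp: less_imp_neq[OF cosine_denominator, symmetric] order_less_imp_not_eq2)

lemma cosine_square: "(cosine t)\<^sup>2 = (max 0 (1 - q t) powr \<beta>)\<^sup>2 / ((max 0 (1 - q t) powr \<beta>)\<^sup>2 + (q t powr \<beta>)\<^sup>2)"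
  using cosine_denominator[of t] by (simp add: cosine_def power_divide)

text \<open>Off the interior of \<open>K\<close>, one minus \<open>q\<close> of either coordinate is
  at most \<open>q\<close> of the other. Hence replacing both denominators by the common value
  \<open>a + a'\<close> can only enlarge the fractions, which then sum to 1.\<close>

lemma cosine_exterior:
  assumes "1 \<le> \<Phi> y"
  shows "(cosine (y $ 1))\<^sup>2 + (cosine (y $ 2))\<^sup>2 \<le> 1"
proof -
  let ?s = "y $ 1" and ?t = "y $ 2"
  define a b a' b' where "a = (max 0 (1 - q ?s) powr \<beta>)\<^sup>2" and "b = (q ?s powr \<beta>)\<^sup>2"
    and "a' = (max 0 (1 - q ?t) powr \<beta>)\<^sup>2" and "b' = (q ?t powr \<beta>)\<^sup>2"
  have "max 0 (1 - q ?s) \<le> q ?t" "max 0 (1 - q ?t) \<le> q ?s"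
    using assms q_nonneg by (auto simp: \<Phi>_def)
  then have le: "a \<le> b'" "a' \<le> b"
    unfolding a_def b_def a'_def b'_def using \<beta>_pos by (intro power_mono powr_mono2; simp)+
  have nn: "0 \<le> a" "0 \<le> a'" by (auto simp: a_def a'_def)
  have "a / (a + b) + a' / (a' + b') \<le> 1"
  proof (cases "a + a' = 0")
    case False
    then have "0 < a + a'" using nn by linarith
    then have "a / (a + b) \<le> a / (a + a')" "a' / (a' + b') \<le> a' / (a + a')"
      using le nn by (intro divide_left_mono mult_pos_pos; linarith)+
    moreover have "a / (a + a') + a' / (a + a') = 1"
      using False by (simp add: add_divide_distrib[symmetric])
    ultimately show ?thesis by linarith
  next
    case True
    then have "a = 0" "a' = 0" using nn by linarith+
    then show ?thesis by simp
  qed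
  then show ?thesis unfolding cosine_square a_def b_def a'_def b'_def .
qed

text \<open>On the arc \<open>q (g t) = 1 - q t\<close>, so changing the coordinate exchanges the
  two terms and turns the cosine into the sine. The range starts at -1 because further left the
  slope is negative whereas \<open>cosine\<close> never is.\<close>

lemma cosine_on_graph:
  assumes "- 1 \<le> t" "t \<le> 7/4"
  shows "cosine t = 1 / sqrt (1 + (slope t)\<^sup>2)" "cosine (g t) = slope t / sqrt (1 + (slope t)\<^sup>2)"
proof -
  have t: "\<bar>t\<bar> \<le> 7/4" using assms by auto
  define x z where "x = (1 - q t) powr \<beta>" and "z = q t powr \<beta>"
  have x: "0 < x" using q_less_1[OF t] by (simp add: x_def)
  have "E t = z"
  proof (cases "1 \<le> t")
    case True
    have "p * \<beta> = \<alpha>" using p_bounds by (simp add: \<beta>_def)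
    then have "z = (t - 1) powr \<alpha>" using True by (simp add: z_def q_ge powr_powr)
    then show ?thesis using True by (simp add: E_def ramp_def)
  next
    case False
    then show ?thesis using assms by (simp add: E_def ramp_def z_def q_flat)
  qed
  then have slope: "slope t = z / x"
    using t by (simp add: slope_def clamp_eq x_def powr_minus_divide)
  have root: "sqrt (1 + (slope t)\<^sup>2) = sqrt (x\<^sup>2 + z\<^sup>2) / x"
  proof -
    have "1 + (slope t)\<^sup>2 = (x\<^sup>2 + z\<^sup>2) / x\<^sup>2" using x by (simp add: slope power_divide field_simps)
    then show ?thesis using x by (simp add: real_sqrt_divide)
  qed
  show "cosine t = 1 / sqrt (1 + (slope t)\<^sup>2)"
    unfolding root using q_less_1[OF t] x by (simp add: cosine_def x_def z_def)
  show "cosine (g t) = slope t / sqrt (1 + (slope t)\<^sup>2)"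
  proof -
    have "cosine (g t) = z / sqrt (x\<^sup>2 + z\<^sup>2)"
      using q_less_1[OF t] q_nonneg[of t] by (simp add: cosine_def q_g[OF t] x_def z_def add.commute)
    then show ?thesis unfolding root using x by (simp add: slope)
  qed
qed

section \<open>Arclength parametrisation of the arc\<close>

definition arclength :: "real \<Rightarrow> real" where
  "arclength = (SOME S. S 1 = 0 \<and> (\<forall>t. (S has_real_derivative sqrt (1 + (slope t)\<^sup>2)) (at t)))"

lemma arclength_1: "arclength 1 = 0"
  and arclength_has_derivative: "(arclength has_real_derivative sqrt (1 + (slope t)\<^sup>2)) (at t)"
proof -
  have "continuous_on UNIV (\<lambda>t. sqrt (1 + (slope t)\<^sup>2))"
    by (intro continuous_intros continuous_on_slope)
  from someI_ex[OF continuous_antiderivative[OF this, of 1 0]]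
  show "arclength 1 = 0" "(arclength has_real_derivative sqrt (1 + (slope t)\<^sup>2)) (at t)"
    unfolding arclength_def by auto
qed

lemma arclength_mvt:
  assumes "s < t"
  obtains z where "arclength t - arclength s = (t - s) * sqrt (1 + (slope z)\<^sup>2)"
  using MVT2[OF assms arclength_has_derivative] by metis

text \<open>The speed is at least 1. This yields injectivity, surjectivity by the intermediate value
  theorem, and a contracting inverse.\<close>

lemma arclength_expands:
  assumes "s \<le> t" shows "t - s \<le> arclength t - arclength s"
proof (cases "s = t")
  case False
  then obtain z where z: "arclength t - arclength s = (t - s) * sqrt (1 + (slope z)\<^sup>2)"
    using assms arclength_mvt[of s t] by (metis less_eq_real_def)
  have "(t - s) * 1 \<le> (t - s) * sqrt (1 + (slope z)\<^sup>2)" using assms by (intro mult_left_mono) auto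
  then show ?thesis using z by simp
qed simp

lemma bij_arclength: "bij arclength"
proof (rule bijI)
  show "inj arclength"
  proof (rule injI)
    fix s t assume "arclength s = arclength t"
    then show "s = t" using arclength_expands[of s t] arclength_expands[of t s] by linarith
  qed
  show "surj arclength"
    unfolding surj_def
  proof
    fix y
    \<comment> \<open>Arclength vanishes at 1 and expands distances, so the value \<open>y\<close>
      is attained within distance |y| of 1.\<close>
    have "continuous_on {1 - \<bar>y\<bar>..1 + \<bar>y\<bar>} arclength"
      by (meson DERIV_isCont arclength_has_derivative continuous_at_imp_continuous_on)
    moreover have "arclength (1 - \<bar>y\<bar>) \<le> y" "y \<le> arclength (1 + \<bar>y\<bar>)"
      using arclength_expands[of "1 - \<bar>y\<bar>" 1] arclength_expands[of 1 "1 + \<bar>y\<bar>"] arclength_1 by auto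
    ultimately show "\<exists>x. y = arclength x"
      using IVT'[of arclength "1 - \<bar>y\<bar>" y "1 + \<bar>y\<bar>"] by force
  qed
qed

definition \<tau> :: "real \<Rightarrow> real" where "\<tau> = inv arclength"

lemma arclength_\<tau>: "arclength (\<tau> s) = s"
  using bij_arclength by (simp add: \<tau>_def bij_is_surj surj_f_inv_f)

lemma \<tau>_0: "\<tau> 0 = 1"
  using bij_arclength arclength_1 unfolding \<tau>_def by (metis bij_inv_eq_iff)

lemma \<tau>_contracts: "\<bar>\<tau> s - \<tau> t\<bar> \<le> \<bar>s - t\<bar>"
  using arclength_expands[of "\<tau> s" "\<tau> t"] arclength_expands[of "\<tau> t" "\<tau> s"]
  unfolding arclength_\<tau> by linarith

lemma \<tau>_has_derivative: "(\<tau> has_real_derivative 1 / sqrt (1 + (slope (\<tau> s))\<^sup>2)) (at s)"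
proof -
  have "continuous_on UNIV \<tau>"
    by (rule continuous_on_iff[THEN iffD2]) (metis \<tau>_contracts dist_real_def le_less_trans)
  then have "isCont \<tau> s" by (simp add: continuous_on_eq_continuous_at)
  moreover have "sqrt (1 + (slope (\<tau> s))\<^sup>2) \<noteq> 0"
    by (metis add_pos_nonneg less_irrefl real_sqrt_eq_zero_cancel_iff zero_le_power2 zero_less_one)
  ultimately show ?thesis
    using DERIV_inverse_function[OF arclength_has_derivative, where g=\<tau> and x=s and a="s - 1" and b="s + 1"] arclength_\<tau>
    by (simp add: inverse_eq_divide)
qed

definition \<gamma> :: "real \<Rightarrow> real^2" where
  "\<gamma> s = \<tau> s *\<^sub>R axis 1 1 + g (\<tau> s) *\<^sub>R axis 2 1"

definition \<gamma>' :: "real \<Rightarrow> real^2" where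
  "\<gamma>' s = (1 / sqrt (1 + (slope (\<tau> s))\<^sup>2)) *\<^sub>R axis 1 1
     + (slope (\<tau> s) / sqrt (1 + (slope (\<tau> s))\<^sup>2)) *\<^sub>R axis 2 1"

lemma \<gamma>_components [simp]:
  "\<gamma> s $ 1 = \<tau> s" "\<gamma> s $ 2 = g (\<tau> s)"
  "\<gamma>' s $ 1 = 1 / sqrt (1 + (slope (\<tau> s))\<^sup>2)" "\<gamma>' s $ 2 = slope (\<tau> s) / sqrt (1 + (slope (\<tau> s))\<^sup>2)"
  by (simp_all add: \<gamma>_def \<gamma>'_def axis_def)

lemma \<gamma>_has_derivative: "(\<gamma> has_derivative (\<lambda>h. h *\<^sub>R \<gamma>' s)) (at s)"
proof -
  have "((\<lambda>s. g (\<tau> s)) has_real_derivative slope (\<tau> s) * (1 / sqrt (1 + (slope (\<tau> s))\<^sup>2))) (at s)"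
    by (rule DERIV_chain2[OF g_has_derivative \<tau>_has_derivative])
  note d = \<tau>_has_derivative[of s, unfolded has_field_derivative_def] this[unfolded has_field_derivative_def]
  show ?thesis
    unfolding \<gamma>_def[abs_def] \<gamma>'_def
    by (rule has_derivative_eq_rhs, (rule has_derivative_add has_derivative_scaleR_left d)+)
      (simp add: fun_eq_iff scaleR_add_right mult.commute)
qed

lemma norm_\<gamma>': "norm (\<gamma>' s) = 1"
proof -
  have "1 + (slope (\<tau> s))\<^sup>2 \<noteq> 0" by (metis add_pos_nonneg less_irrefl zero_le_power2 zero_less_one)
  then have "(norm (\<gamma>' s))\<^sup>2 = 1"
    by (simp add: power2_norm_eq_inner inner_vec_def sum_2 power2_eq_square[symmetric] power_divide add_divide_distrib[symmetric])
  then show ?thesis using power2_eq_iff_nonneg[of "norm (\<gamma>' s)" 1] by simp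
qed

lemma \<gamma>'_holder:
  obtains C where "\<And>s t. norm (\<gamma>' s - \<gamma>' t) \<le> C * \<bar>s - t\<bar> powr \<alpha>"
proof -
  obtain C where C: "\<And>x y. \<bar>slope x - slope y\<bar> \<le> C * \<bar>x - y\<bar> powr \<alpha>" "0 \<le> C" using slope_holder by metis
  have "norm (\<gamma>' s - \<gamma>' t) \<le> (3 * C) * \<bar>s - t\<bar> powr \<alpha>" for s t
  proof -
    \<comment> \<open>The Lipschitz constants 1 and 2 of the two components add up to 3.\<close>
    have "norm (\<gamma>' s - \<gamma>' t) \<le> 3 * \<bar>slope (\<tau> s) - slope (\<tau> t)\<bar>"
      using norm_le_l1_cart[of "\<gamma>' s - \<gamma>' t"] unit_tangent_lipschitz[of "slope (\<tau> s)" "slope (\<tau> t)"]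
      by (simp add: UNIV_2)
    also have "\<dots> \<le> 3 * (C * \<bar>\<tau> s - \<tau> t\<bar> powr \<alpha>)" using C(1) by (intro mult_left_mono) auto
    also have "\<dots> \<le> 3 * (C * \<bar>s - t\<bar> powr \<alpha>)"
      using C(2) \<alpha>_pos \<tau>_contracts by (intro mult_left_mono powr_mono2) auto
    finally show ?thesis by simp
  qed
  then show ?thesis by (rule that)
qed

lemma continuous_on_\<gamma>': "continuous_on S \<gamma>'"
proof -
  obtain C where C: "\<And>s t. norm (\<gamma>' s - \<gamma>' t) \<le> C * \<bar>s - t\<bar> powr \<alpha>" using \<gamma>'_holder by metis
  then have "holder_on \<alpha> S \<gamma>'" by (auto simp: holder_on_def dist_norm)
  then show ?thesis using \<alpha>_pos by (rule holder_on_continuous)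
qed

text \<open>A contraction with \<open>\<tau> 0 = 1\<close> keeps parameters up to 1/2 within
  [1/2, 3/2], inside the range of \<open>cosine_on_graph\<close>; hence the radius 1/2 of the
  domain.\<close>

lemma \<tau>_range: "\<bar>s\<bar> \<le> 1/2 \<Longrightarrow> - 1 \<le> \<tau> s \<and> \<tau> s \<le> 7/4"
  using \<tau>_contracts[of s 0] \<tau>_0 by (auto simp: abs_le_iff)

text \<open>Right of the junction the slope is at least the \<alpha>-th power of
  \<open>\<tau> s - 1\<close>, and bounded speed makes \<open>\<tau> s - 1\<close> at least s / M. A
  Lipschitz bound at 0 would give s^\<alpha> <= const * s, impossible as s tends to 0.\<close>

lemma \<gamma>'_not_lipschitz:
  assumes "0 < \<delta>" "\<And>s. 0 < s \<Longrightarrow> s < \<delta> \<Longrightarrow> norm (\<gamma>' s - \<gamma>' 0) \<le> C * s"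
  shows False
proof -
  obtain B where B: "\<And>t. \<bar>slope t\<bar> \<le> B" using slope_bounded by metis
  define M where "M = sqrt (1 + B\<^sup>2)"
  have M: "1 \<le> M" by (simp add: M_def)
  have RM: "sqrt (1 + (slope t)\<^sup>2) \<le> M" for t
    using B[of t] power_mono[OF B[of t], of 2] by (simp add: M_def)
  have slope1: "slope 1 = 0" by (simp add: slope_def clamp_def E_def ramp_def)
  define \<eta> where "\<eta> = min \<delta> (1/2)"
  have key: "1 \<le> (C * M * M powr \<alpha>) * ramp (1 - \<alpha>) s" if s: "0 < s" "s < \<eta>" for s
  proof -
    have \<tau>: "1 < \<tau> s" 
    proof (rule ccontr)
      assume "\<not> 1 < \<tau> s"
      then show False using arclength_expands[of "\<tau> s" 1] s by (simp add: arclength_\<tau> arclength_1)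
    qed
    have \<tau>': "\<tau> s \<le> 7/4" using \<tau>_range[of s] s by (auto simp: \<eta>_def)
    obtain z where "arclength (\<tau> s) - arclength 1 = (\<tau> s - 1) * sqrt (1 + (slope z)\<^sup>2)"
      using arclength_mvt[OF \<tau>] by metis
    then have "s \<le> (\<tau> s - 1) * M"
      using mult_left_mono[OF RM[of z], of "\<tau> s - 1"] \<tau> unfolding arclength_\<tau> arclength_1 by linarith
    then have "s powr \<alpha> \<le> ((\<tau> s - 1) * M) powr \<alpha>" using s \<alpha>_pos by (intro powr_mono2) auto
    also have "\<dots> = (\<tau> s - 1) powr \<alpha> * M powr \<alpha>" using \<tau> M by (simp add: powr_mult)
    finally have 0: "s powr \<alpha> \<le> (\<tau> s - 1) powr \<alpha> * M powr \<alpha>" .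
    have slope_ge: "(\<tau> s - 1) powr \<alpha> \<le> slope (\<tau> s)"
    proof -
      \<comment> \<open>A negative power of a number in (0, 1] is at least 1.\<close>
      have "1 \<le> (1 - q (\<tau> s)) powr (- \<beta>)"
        using powr_mono2'[of "- \<beta>" "1 - q (\<tau> s)" 1] \<beta>_pos q_less_1[of "\<tau> s"] q_nonneg[of "\<tau> s"] \<tau> \<tau>' by simp
      then have "E (\<tau> s) * 1 \<le> E (\<tau> s) * (1 - q (\<tau> s)) powr (- \<beta>)"
        using \<tau> by (intro mult_left_mono) (auto simp: E_def ramp_def)
      then show ?thesis using \<tau> \<tau>' by (simp add: slope_def clamp_eq E_def ramp_def)
    qed
    have 1: "s powr \<alpha> \<le> slope (\<tau> s) * M powr \<alpha>"
      using 0 mult_right_mono[OF slope_ge, of "M powr \<alpha>"] by simp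
    have pos: "0 < s powr \<alpha>" using s by simp
    have sl: "0 \<le> slope (\<tau> s)" using slope_ge by (rule order_trans[OF powr_ge_zero])
    have "slope (\<tau> s) / M \<le> slope (\<tau> s) / sqrt (1 + (slope (\<tau> s))\<^sup>2)"
      using sl RM M by (intro divide_left_mono mult_pos_pos) (auto simp: add_pos_nonneg)
    also have "\<dots> = (\<gamma>' s - \<gamma>' 0) $ 2" by (simp add: \<tau>_0 slope1)
    also have "\<dots> \<le> norm (\<gamma>' s - \<gamma>' 0)"
      using component_le_norm_cart[of "\<gamma>' s - \<gamma>' 0" 2] by linarith
    also have "\<dots> \<le> C * s" using assms(2) s by (simp add: \<eta>_def)
    finally have "slope (\<tau> s) \<le> C * s * M" using M by (simp add: pos_divide_le_eq)
    then have "slope (\<tau> s) * M powr \<alpha> \<le> C * s * M * M powr \<alpha>" by (intro mult_right_mono) auto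
    then have "s powr \<alpha> \<le> (C * M * M powr \<alpha>) * s" using 1 by (simp add: algebra_simps)
    moreover have "s powr (1 - \<alpha>) * s powr \<alpha> = s" using s by (simp add: powr_add[symmetric])
    ultimately have "1 * s powr \<alpha> \<le> (C * M * M powr \<alpha> * s powr (1 - \<alpha>)) * s powr \<alpha>"
      unfolding mult.assoc by simp
    then have "1 \<le> C * M * M powr \<alpha> * s powr (1 - \<alpha>)" using pos by (rule mult_right_le_imp_le)
    then show ?thesis using s by (simp add: ramp_def)
  qed
  have "1 \<le> (0::real)"
  proof (rule tendsto_lowerbound)
    have "continuous_on UNIV (\<lambda>s. (C * M * M powr \<alpha>) * ramp (1 - \<alpha>) s)"
      using \<alpha>_less_1 by (intro continuous_intros) auto
    then have "((\<lambda>s. (C * M * M powr \<alpha>) * ramp (1 - \<alpha>) s) \<longlongrightarrow> (C * M * M powr \<alpha>) * ramp (1 - \<alpha>) 0) (at_right 0)"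
      by (auto simp: continuous_on_def intro: tendsto_within_subset)
    then show "((\<lambda>s. (C * M * M powr \<alpha>) * ramp (1 - \<alpha>) s) \<longlongrightarrow> 0) (at_right 0)" by (simp add: ramp_def)
    show "\<forall>\<^sub>F s in at_right 0. 1 \<le> (C * M * M powr \<alpha>) * ramp (1 - \<alpha>) s"
      using key assms(1) unfolding eventually_at_right_field
      by (intro exI[of _ \<eta>]) (auto simp: \<eta>_def)
  qed simp
  then show False by simp
qed

section \<open>The calibration and its gradient\<close>

definition primitive :: "real \<Rightarrow> real" where
  "primitive = (SOME F. F 0 = 0 \<and> (\<forall>t. (F has_real_derivative cosine t) (at t)))"

lemma primitive_has_derivative: "(primitive has_real_derivative cosine t) (at t)"
  using someI_ex[OF continuous_antiderivative[OF continuous_on_cosine[OF continuous_on_id], of 0 0]]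
  unfolding primitive_def by auto

definition calibration :: "real^2 \<Rightarrow> real" where
  "calibration y = primitive (y $ 1) + primitive (y $ 2)"

definition calibration_gradient :: "real^2 \<Rightarrow> real^2" where
  "calibration_gradient y = cosine (y $ 1) *\<^sub>R axis 1 1 + cosine (y $ 2) *\<^sub>R axis 2 1"

lemma calibration_gradient_components [simp]:
  "calibration_gradient y $ 1 = cosine (y $ 1)" "calibration_gradient y $ 2 = cosine (y $ 2)"
  by (simp_all add: calibration_gradient_def axis_def)

lemma calibration_has_derivative:
  "(calibration has_derivative (\<lambda>h. calibration_gradient y \<bullet> h)) (at y)"
proof -
  have "((\<lambda>y::real^2. primitive (y $ i)) has_derivative (\<lambda>h. cosine (y $ i) * h $ i)) (at y)" for i
    by (rule has_derivative_compose[OF bounded_linear.has_derivative[OF bounded_linear_vec_nth has_derivative_ident]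
          primitive_has_derivative[unfolded has_field_derivative_def]])
  from has_derivative_add[OF this[of 1] this[of 2]] show ?thesis
    unfolding calibration_def[abs_def] by (rule has_derivative_eq_rhs) (simp add: inner_vec_def sum_2 fun_eq_iff)
qed

lemma continuous_on_calibration_gradient: "continuous_on S calibration_gradient"
  unfolding calibration_gradient_def[abs_def] by (intro continuous_intros)

lemma norm_calibration_gradient_square:
  "(norm (calibration_gradient y))\<^sup>2 = (cosine (y $ 1))\<^sup>2 + (cosine (y $ 2))\<^sup>2"
  unfolding power2_norm_eq_inner by (simp add: inner_vec_def sum_2 power2_eq_square)

text \<open>Inside \<open>K\<close> the field can be longer than one, with length sqrt 2 at the
  origin; this crude bound serves for approximations that enter \<open>K\<close>.\<close>

lemma norm_calibration_gradient_le: "norm (calibration_gradient y) \<le> 2"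
proof (rule power2_le_imp_le)
  have "(cosine t)\<^sup>2 \<le> 1" for t
    unfolding cosine_square using cosine_denominator[of t] by (simp add: divide_le_eq)
  from add_mono[OF this[of "y $ 1"] this[of "y $ 2"]]
  show "(norm (calibration_gradient y))\<^sup>2 \<le> 2\<^sup>2" by (simp add: norm_calibration_gradient_square)
qed simp

lemma norm_calibration_gradient_exterior:
  assumes "y \<notin> interior K" shows "norm (calibration_gradient y) \<le> 1"
proof (rule power2_le_imp_le)
  show "(norm (calibration_gradient y))\<^sup>2 \<le> 1\<^sup>2"
    using assms cosine_exterior[of y] by (simp add: norm_calibration_gradient_square interior_K)
qed simp

lemma calibration_gradient_tangent:
  assumes "\<bar>s\<bar> \<le> 1/2" shows "calibration_gradient (\<gamma> s) \<bullet> \<gamma>' s = 1"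
proof -
  note \<tau> = conjunct1[OF \<tau>_range[OF assms]] conjunct2[OF \<tau>_range[OF assms]]
  have "calibration_gradient (\<gamma> s) = \<gamma>' s"
    by (simp add: vec_eq_iff forall_2 cosine_on_graph[OF \<tau>])
  then show ?thesis using norm_\<gamma>'[of s] by (simp add: dot_square_norm)
qed

lemma \<gamma>_exterior:
  assumes "\<bar>s\<bar> \<le> 1/2" shows "\<gamma> s \<notin> interior K"
proof -
  have "\<bar>\<tau> s\<bar> \<le> 7/4" using \<tau>_range[OF assms] by (auto simp: abs_le_iff)
  then show ?thesis using q_g[of "\<tau> s"] by (simp add: interior_K \<Phi>_def)
qed

end

section \<open>Assembly of the example\<close>

lemma norm_matrix_of_columns_one:
  fixes a :: "real^'m" and i :: "'n::finite"
  shows "norm (\<chi> j k. if k = i then a $ j else 0 :: real^'n^'m) = norm a"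
proof -
  have "norm (\<chi> k. if k = i then c else 0 :: real^'n) = \<bar>c\<bar>" for c :: real
  proof -
    have "(\<chi> k. if k = i then c else 0 :: real^'n) = c *\<^sub>R axis i 1" by (simp add: vec_eq_iff axis_def)
    then show ?thesis by simp
  qed
  then show ?thesis by (simp add: norm_vec_def[where 'a="real^'n"] norm_vec_def[of a])
qed

theorem theorem1p3:
  fixes \<alpha> :: real
  assumes "0 < \<alpha>" and "\<alpha> < 1"
  shows "\<exists>(K :: (real^2) set) (\<Omega> :: (real^'n) set) (u :: real^'n \<Rightarrow> real^2) (x0 :: real^'n).
    convex_body K \<and> C1_holder_boundary \<alpha> K \<and> \<not> C1_holder_boundary 1 K \<and>
    bounded_lipschitz_domain \<Omega> \<and>
    C1_holder \<alpha> \<Omega> u \<and> u \<in> W12_into \<Omega> (UNIV - interior K) \<and>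
    x0 \<in> \<Omega> \<and>
    (\<forall>v\<in>W12_into \<Omega> (UNIV - interior K).
      (\<lambda>x. v x - u x) \<in> W12_0 \<Omega> \<longrightarrow> dirichlet_energy \<Omega> u \<le> dirichlet_energy \<Omega> v) \<and>
    (\<forall>U. open U \<and> x0 \<in> U \<and> U \<subseteq> \<Omega> \<longrightarrow> \<not> C1_holder 1 U u)"
proof -
  interpret hoelder_exponent \<alpha> by unfold_locales (fact assms)+
  \<comment> \<open>Any coordinate will do; the index type is never empty, so n = 1 is
    included.\<close>
  define i :: 'n where "i = undefined"
  define \<Omega> :: "(real^'n) set" where "\<Omega> = ball 0 (1/2)"
  define u :: "real^'n \<Rightarrow> real^2" where "u x = \<gamma> (x $ i)" for x
  define u' :: "real^'n \<Rightarrow> real^'n \<Rightarrow> real^2" where "u' x h = h $ i *\<^sub>R \<gamma>' (x $ i)" for x h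
  have \<Omega>: "open \<Omega>" "bounded \<Omega>" by (auto simp: \<Omega>_def)
  have range: "\<bar>x $ i\<bar> \<le> 1/2" if "x \<in> \<Omega>" for x
    using component_le_norm_cart[of x i] that by (simp add: \<Omega>_def)
  have deriv: "(u has_derivative u' x) (at x)" for x
    unfolding u_def[abs_def] u'_def[abs_def]
    by (rule has_derivative_compose[OF bounded_linear.has_derivative[OF bounded_linear_vec_nth has_derivative_ident] \<gamma>_has_derivative])
  have cont\<gamma>: "continuous_on S (\<lambda>x::real^'n. \<gamma>' (x $ i))" for S
    by (intro continuous_on_compose2[OF continuous_on_\<gamma>'[of UNIV]] continuous_intros) auto
  have contu': "continuous_on UNIV (\<lambda>x. u' x h)" for h
    unfolding u'_def by (intro continuous_intros cont\<gamma>)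
  have u'_i: "u' x (axis i 1) = \<gamma>' (x $ i)" for x
    by (simp add: u'_def axis_def)
  have energy: "dirichlet_energy \<Omega> u = measure lebesgue \<Omega>"
  proof -
    \<comment> \<open>Only column \<open>i\<close> is nonzero and it is a unit vector, so the energy
      is the volume, the very value of the calibration bound.\<close>
    have "jacobian u' x = (\<chi> j k. if k = i then \<gamma>' (x $ i) $ j else 0)" for x
      by (simp add: jacobian_def u'_def axis_def vec_eq_iff)
    then have "norm (jacobian u' x) = 1" for x
      by (simp add: norm_matrix_of_columns_one norm_\<gamma>')
    then have "dirichlet_energy \<Omega> u = (\<integral>x. 1 \<partial>lebesgue_on \<Omega>)"
      using C1_W12(2)[OF \<Omega> deriv contu'] by simp
    also have "\<dots> = measure lebesgue \<Omega>"
      using finite_measure_lebesgue_on[OF \<Omega>] by (simp add: space_restrict_space)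
    finally show ?thesis .
  qed
  have u_into: "u \<in> W12_into \<Omega> (UNIV - interior K)"
    unfolding W12_into_def using C1_W12(1)[OF \<Omega> deriv contu'] \<gamma>_exterior range
    by (auto simp: u_def space_restrict_space intro!: AE_I2)
  have minimal: "dirichlet_energy \<Omega> u \<le> dirichlet_energy \<Omega> v"
    if v: "v \<in> W12_into \<Omega> (UNIV - interior K)" "(\<lambda>x. v x - u x) \<in> W12_0 \<Omega>" for v
    unfolding energy
  proof (rule calibration_dirichlet_lower_bound[OF \<Omega> deriv contu' calibration_has_derivative
        continuous_on_calibration_gradient norm_calibration_gradient_le _ _ _ v(2)])
    show "calibration_gradient (u x) \<bullet> u' x (axis i 1) = 1" if "x \<in> \<Omega>" for x
      using calibration_gradient_tangent[OF range[OF that]] by (simp add: u_def u'_i)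
    show "v \<in> W12 \<Omega>" using v by (simp add: W12_into_def)
    have "AE x in lebesgue_on \<Omega>. v x \<in> UNIV - interior K" using v by (simp add: W12_into_def)
    then show "AE x in lebesgue_on \<Omega>. norm (calibration_gradient (v x)) \<le> 1"
      by eventually_elim (simp add: norm_calibration_gradient_exterior)
  qed
  have holder: "C1_holder \<alpha> \<Omega> u"
  proof -
    obtain C where C: "\<And>s t. norm (\<gamma>' s - \<gamma>' t) \<le> C * \<bar>s - t\<bar> powr \<alpha>" using \<gamma>'_holder by metis
    have C0: "0 \<le> C" using order_trans[OF norm_ge_zero C[of 1 0]] by simp
    define L :: "(real^'n) \<Rightarrow>\<^sub>L real" where "L = Blinfun (\<lambda>h. h $ i)"
    have L: "blinfun_apply L h = h $ i" for h
      unfolding L_def by (simp add: bounded_linear_Blinfun_apply bounded_linear_vec_nth)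
    define D :: "real^'n \<Rightarrow> (real^'n) \<Rightarrow>\<^sub>L (real^2)" where "D x = blinfun_scaleR_left (\<gamma>' (x $ i)) o\<^sub>L L" for x
    have D: "blinfun_apply (D x) = u' x" for x
      by (simp add: D_def L u'_def fun_eq_iff)
    have "dist (D x) (D y) \<le> C * dist x y powr \<alpha>" for x y
      unfolding dist_norm
    proof (rule norm_blinfun_bound)
      show "0 \<le> C * norm (x - y) powr \<alpha>" using C0 by simp
      fix h
      have "norm (blinfun_apply (D x - D y) h) = \<bar>h $ i\<bar> * norm (\<gamma>' (x $ i) - \<gamma>' (y $ i))"
        by (simp add: blinfun.diff_left D u'_def scaleR_diff_right[symmetric])
      also have "\<dots> \<le> norm h * (C * norm (x - y) powr \<alpha>)"
      proof (intro mult_mono component_le_norm_cart)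
        have "norm (\<gamma>' (x $ i) - \<gamma>' (y $ i)) \<le> C * \<bar>(x - y) $ i\<bar> powr \<alpha>" using C by simp
        also have "\<dots> \<le> C * norm (x - y) powr \<alpha>"
          using C0 \<alpha>_pos component_le_norm_cart[of "x - y" i] by (intro mult_left_mono powr_mono2) auto
        finally show "norm (\<gamma>' (x $ i) - \<gamma>' (y $ i)) \<le> C * norm (x - y) powr \<alpha>" .
      qed auto
      finally show "norm (blinfun_apply (D x - D y) h) \<le> C * norm (x - y) powr \<alpha> * norm h"
        by (simp add: mult.commute)
    qed
    then have "holder_on \<alpha> (closure \<Omega>) D" by (auto simp: holder_on_def)
    moreover from this have "continuous_on (closure \<Omega>) D" using \<alpha>_pos by (rule holder_on_continuous)
    moreover have "continuous_on (closure \<Omega>) u"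
      using deriv by (meson continuous_at_imp_continuous_on has_derivative_continuous)
    ultimately show ?thesis using deriv by (auto simp: C1_holder_def D intro!: exI[of _ D])
  qed
  \<comment> \<open>Applied to the \<open>i\<close>-th axis vector, the derivative of
    \<open>u\<close> is \<gamma>' of the \<open>i\<close>-th coordinate; restricting to that axis
    would make \<gamma>' Lipschitz at 0.\<close>
  have singular: "\<not> C1_holder 1 U u" if U: "open U" "0 \<in> U" for U
  proof
    assume "C1_holder 1 U u"
    then obtain D :: "real^'n \<Rightarrow> (real^'n) \<Rightarrow>\<^sub>L (real^2)"
      where D: "\<And>x. x \<in> U \<Longrightarrow> (u has_derivative blinfun_apply (D x)) (at x)" and h: "holder_on 1 (closure U) D"
      by (auto simp: C1_holder_def)
    obtain C where "\<And>x y. x \<in> closure U \<Longrightarrow> y \<in> closure U \<Longrightarrow> dist (D x) (D y) \<le> C * dist x y powr 1"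
      using h unfolding holder_on_def by blast
    then have C: "norm (D x - D y) \<le> C * norm (x - y)" if "x \<in> U" "y \<in> U" for x y
      using that closure_subset[of U] by (auto simp: dist_norm subset_iff)
    obtain \<delta> where \<delta>: "0 < \<delta>" "ball 0 \<delta> \<subseteq> U" using U open_contains_ball by blast
    have eq: "D x (axis i 1) = \<gamma>' (x $ i)" if "x \<in> U" for x
      using has_derivative_unique[OF D[OF that] deriv] u'_i by simp
    have "norm (\<gamma>' s - \<gamma>' 0) \<le> C * s" if s: "0 < s" "s < \<delta>" for s
    proof -
      define x :: "real^'n" where "x = s *\<^sub>R axis i 1"
      have n: "norm x = s" using s by (simp add: x_def)
      then have "x \<in> ball 0 \<delta>" using s by simp
      then have x: "x \<in> U" using \<delta>(2) by blast
      have xi: "x $ i = s" by (simp add: x_def axis_def)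
      have "norm (\<gamma>' s - \<gamma>' 0) = norm (blinfun_apply (D x - D 0) (axis i 1))"
        using eq[OF x] eq[OF U(2)] xi by (simp add: blinfun.diff_left)
      also have "\<dots> \<le> norm (D x - D 0) * norm (axis i (1::real))" by (rule norm_blinfun)
      also have "\<dots> \<le> C * s" using C[OF x U(2)] n by simp
      finally show ?thesis .
    qed
    then show False using \<gamma>'_not_lipschitz[OF \<delta>(1)] by blast
  qed
  show ?thesis
  proof (intro exI conjI ballI allI impI)
    show "convex_body K" by (rule convex_body_K)
    show "C1_holder_boundary \<alpha> K" by (rule C1_holder_boundary_K)
    show "\<not> C1_holder_boundary 1 K" by (rule not_C11_boundary_K)
    show "bounded_lipschitz_domain \<Omega>" unfolding \<Omega>_def by (rule bounded_lipschitz_domain_ball) simp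
    show "(0 :: real^'n) \<in> \<Omega>" by (simp add: \<Omega>_def)
  qed (use holder u_into minimal singular in auto)
qed

end
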